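(* Suppose $\mu=0$. For any $\epsilon>0$, run Catalyst(SGD) (defined in the context) from $\bar x_0=\tilde x_0$ with $$K=4\sqrt{\frac{L\|x^*-\bar x_0\|^2}{\epsilon}},\quad \gamma_k=\frac{2}{k+1},\quad \beta_k=\frac{(k+1)L}{k},\quad \alpha_k=\frac{\beta_k}{1-\Lambda_T},$$ where $$T=8+\frac{32\sigma^2K}{L\epsilon},\qquad \Lambda_T=\frac{90}{(T+9)(T+10)}.$$ At the $k$-th iteration, let the proximal step $\min_{u\in X}\phi_k(u)$ be solved by running SGD$(\phi_k)$ (for $T$ steps) with stepsizes $\eta_t=\frac{2}{\beta_k(t+8)}$. Then $$\mathbb E[f(\tilde x_K)-f(x^* )]\le\epsilon .$$ The number of calls to the stochastic first-order oracle is bounded by $$\mathcal O\left(\sqrt{\frac{L\|x^*-\bar x_0\|^2}{\epsilon}}+\frac{\sigma^2\|x^*-\bar x_0\|^2}{\epsilon^2}\right).$$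
   Context: Setting: $\|\cdot\|$ is a norm and $\|\cdot\|_*$ its dual norm. $X\subseteq\mathbb R^d$ is a closed convex set and $f:X\to\mathbb R$ is a differentiable convex function such that, for some $\mu\ge0$, $f(\gamma x_1+(1-\gamma)x_2)\le\gamma f(x_1)+(1-\gamma)f(x_2)-\frac{\mu\gamma(1-\gamma)}{2}\|x_1-x_2\|^2$ for all $x_1,x_2\in X$ (and $\gamma\in[0,1]$), and $f$ is smooth with modulus $L$: $|f(x_2)-f(x_1)-\langle\nabla f(x_1),x_2-x_1\rangle|\le\frac L2\|x_1-x_2\|^2$ for all $x_1,x_2\in X$. The problem is $\min_{x\in X}f(x)$, and $x^*$ denotes a minimizer. Stochastic first-order oracle (SFO): a call at $x$ with random sample $\xi$ outputs $\nabla f(x;\xi)$ with $\mathbb E_\xi[\nabla f(x;\xi)]=\nabla f(x)$ and $\mathbb E_\xi\|\nabla f(x;\xi)-\nabla f(x)\|_*^2\le\sigma^2$. Catalyst(SGD): given $\bar x_0=\tilde x_0$, for $k=1,\dots,K$: (i) $\hat x_k=\gamma_k\bar x_{k-1}+(1-\gamma_k)\tilde x_{k-1}$; (ii) with $\phi_k(u)=f(u)+\frac{\beta_k}{2}\|u-\hat x_k\|^2$, let $(\tilde x_k,x_k)=(\bar u_T,u_T)$ be the output of SGD$(\phi_k)$; (iii) $\bar x_k=\frac{1}{\alpha_k\gamma_k+\mu(1-\gamma_k)}\left[\alpha_kx_k+(\mu-\alpha_k)(1-\gamma_k)\tilde x_{k-1}\right]$. The output is $\tilde x_K$. SGD$(\phi_k)$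 with stepsizes $\{\eta_t\}$ and $T$ steps: $u_0=\hat x_k$; for $t=1,\dots,T$, $g_{t-1}=\nabla f(u_{t-1};\xi_{t-1})+\beta_k(u_{t-1}-\hat x_k)$, where $\nabla f(u_{t-1};\xi_{t-1})$ is an SFO output, and $u_t=\arg\min_{u\in X}\{\langle g_{t-1},u\rangle+\frac1{2\eta_t}\|u-u_{t-1}\|^2\}$. It outputs $u_T$ and the average $\bar u_T=\frac{\Lambda_T}{1-\Lambda_T}\sum_{t=1}^T\frac{\eta_t\mu_\phi}{\Lambda_t}u_t$, where in this average $\Lambda_0=1$, $\Lambda_t=(1-\eta_t\mu_\phi)\Lambda_{t-1}$ for $t\ge1$, and $\mu_\phi$ is the strong-convexity modulus of $\phi_k$ (taken to be $\beta_k$). The parameter $\alpha_k$ uses the value of $\Lambda_T$ displayed in the claim.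
   Formalization: The norm is Euclidean (claim fails for general norms); f and the oracle live on a convex D ⊇ X containing all x̂_k, which may leave X; K and T are rounded up; the O-bound is for ε ≤ cL‖x*−x̄_0‖² with constant depending on c, since K ≥ 1, T ≥ 8. *)

theory Defs
  imports "HOL-Probability.Probability"
begin

text \<open>
  Throughout, \<open>'a\<close> is a finite-dimensional inner product space and the norm is the one induced by
  the inner product: the vector \<open>\<nabla>f(u;\<xi>) + \<beta> (u - c)\<close> used by SGD below is a stochastic gradient of
  \<open>f(u) + \<beta>/2 \<parallel>u - c\<parallel>\<^sup>2\<close> only for that norm.
\<close>

definition dual_norm :: "'a::real_inner \<Rightarrow> real" where
  "dual_norm g = onorm (\<lambda>h. g \<bullet> h)"

lemma dual_norm_eq_norm: "dual_norm g = norm g"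
proof (rule antisym)
  show "dual_norm g \<le> norm g"
    unfolding dual_norm_def by (rule onorm_bound) (auto simp: Cauchy_Schwarz_ineq2)
  have "norm (g \<bullet> g) \<le> dual_norm g * norm g"
    unfolding dual_norm_def by (rule onorm) (rule bounded_linear_inner_right)
  then show "norm g \<le> dual_norm g"
    by (cases "g = 0") (auto simp: dot_square_norm power2_eq_square dual_norm_def onorm_zero)
qed

definition strongly_convex_with :: "real \<Rightarrow> 'a::real_normed_vector set \<Rightarrow> ('a \<Rightarrow> real) \<Rightarrow> bool" where
  "strongly_convex_with \<mu> D f \<longleftrightarrow>
    (\<forall>x\<^sub>1\<in>D. \<forall>x\<^sub>2\<in>D. \<forall>\<gamma>\<in>{0..1}.
      f (\<gamma> *\<^sub>R x\<^sub>1 + (1 - \<gamma>) *\<^sub>R x\<^sub>2)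
        \<le> \<gamma> * f x\<^sub>1 + (1 - \<gamma>) * f x\<^sub>2 - \<mu> * \<gamma> * (1 - \<gamma>) / 2 * (norm (x\<^sub>1 - x\<^sub>2))\<^sup>2)"

definition gradient_on :: "'a::real_inner set \<Rightarrow> ('a \<Rightarrow> real) \<Rightarrow> ('a \<Rightarrow> 'a) \<Rightarrow> bool" where
  "gradient_on D f f' \<longleftrightarrow> (\<forall>x\<in>D. (f has_derivative (\<lambda>h. f' x \<bullet> h)) (at x within D))"

definition smooth_with :: "real \<Rightarrow> 'a::real_inner set \<Rightarrow> ('a \<Rightarrow> real) \<Rightarrow> ('a \<Rightarrow> 'a) \<Rightarrow> bool" where
  "smooth_with L D f f' \<longleftrightarrow>
    (\<forall>x\<^sub>1\<in>D. \<forall>x\<^sub>2\<in>D. \<bar>f x\<^sub>2 - f x\<^sub>1 - f' x\<^sub>1 \<bullet> (x\<^sub>2 - x\<^sub>1)\<bar> \<le> L / 2 * (norm (x\<^sub>1 - x\<^sub>2))\<^sup>2)"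

text \<open>
  \<open>G x s\<close> is the answer of the oracle to a query at \<open>x\<close> with sample \<open>s\<close>; \<open>\<xi>\<close> is the random sample of
  a call. Integrability is required explicitly, the Bochner integral being \<open>0\<close> otherwise.
\<close>

definition sfo_call ::
  "'w measure \<Rightarrow> 'a::euclidean_space set \<Rightarrow> ('a \<Rightarrow> 'a) \<Rightarrow> real \<Rightarrow> ('a \<Rightarrow> 's \<Rightarrow> 'a) \<Rightarrow> ('w \<Rightarrow> 's) \<Rightarrow> bool" where
  "sfo_call M D f' \<sigma> G \<xi> \<longleftrightarrow>
    (\<forall>x\<in>D.
      integrable M (\<lambda>\<omega>. G x (\<xi> \<omega>)) \<and>
      (\<integral>\<omega>. G x (\<xi> \<omega>) \<partial>M) = f' x \<and>
      integrable M (\<lambda>\<omega>. (dual_norm (G x (\<xi> \<omega>) - f' x))\<^sup>2) \<and>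
      (\<integral>\<omega>. (dual_norm (G x (\<xi> \<omega>) - f' x))\<^sup>2 \<partial>M) \<le> \<sigma>\<^sup>2)"

subsection \<open>SGD on a proximal subproblem\<close>

definition prox_step :: "'a::euclidean_space set \<Rightarrow> real \<Rightarrow> 'a \<Rightarrow> 'a \<Rightarrow> 'a" where
  "prox_step X \<eta> g u = arg_min_on (\<lambda>v. g \<bullet> v + 1 / (2 * \<eta>) * (norm (v - u))\<^sup>2) X"

text \<open>
  The state after \<open>t\<close> steps is \<open>u\<^sub>t\<close> together with the number of oracle calls made so far; \<open>c\<close> is the
  prox centre, \<open>\<beta>\<close> the prox coefficient and \<open>s t\<close> the sample of the call at \<open>u\<^sub>t\<close>.
\<close>

primrec sgd_state ::
  "'a::euclidean_space set \<Rightarrow> ('a \<Rightarrow> 's \<Rightarrow> 'a) \<Rightarrow> real \<Rightarrow> 'a \<Rightarrow> (nat \<Rightarrow> real) \<Rightarrow> (nat \<Rightarrow> 's) \<Rightarrow> nat \<Rightarrow> 'a \<times> nat"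
where
  "sgd_state X G \<beta> c \<eta> s 0 = (c, 0)"
| "sgd_state X G \<beta> c \<eta> s (Suc t) =
    (let (u, n) = sgd_state X G \<beta> c \<eta> s t;
         g = G u (s t) + \<beta> *\<^sub>R (u - c)
     in (prox_step X (\<eta> (Suc t)) g u, Suc n))"

primrec sgd_Lambda :: "(nat \<Rightarrow> real) \<Rightarrow> real \<Rightarrow> nat \<Rightarrow> real" where
  "sgd_Lambda \<eta> \<mu>\<^sub>\<phi> 0 = 1"
| "sgd_Lambda \<eta> \<mu>\<^sub>\<phi> (Suc t) = (1 - \<eta> (Suc t) * \<mu>\<^sub>\<phi>) * sgd_Lambda \<eta> \<mu>\<^sub>\<phi> t"

text \<open>The result is \<open>(\<open>average of the iterates\<close>, u\<^sub>T, \<open>number of oracle calls\<close>)\<close>.\<close>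

definition sgd ::
  "'a::euclidean_space set \<Rightarrow> ('a \<Rightarrow> 's \<Rightarrow> 'a) \<Rightarrow> real \<Rightarrow> 'a \<Rightarrow> (nat \<Rightarrow> real) \<Rightarrow> nat \<Rightarrow> (nat \<Rightarrow> 's)
    \<Rightarrow> 'a \<times> 'a \<times> nat"
where
  "sgd X G \<beta> c \<eta> T s =
    (let u = (\<lambda>t. fst (sgd_state X G \<beta> c \<eta> s t));
         \<mu>\<^sub>\<phi> = \<beta>;
         \<Lambda> = sgd_Lambda \<eta> \<mu>\<^sub>\<phi>
     in ((\<Lambda> T / (1 - \<Lambda> T)) *\<^sub>R (\<Sum>t=1..T. (\<eta> t * \<mu>\<^sub>\<phi> / \<Lambda> t) *\<^sub>R u t),
         u T,
         snd (sgd_state X G \<beta> c \<eta> s T)))"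

subsection \<open>Catalyst(SGD)\<close>

text \<open>
  The parameters of iteration \<open>k\<close> are \<open>\<gamma> k\<close>, \<open>\<beta> k\<close>, \<open>\<alpha> k\<close> and the stepsizes \<open>\<eta> k t\<close>; \<open>s k t\<close> is the sample
  of the call at \<open>u\<^sub>t\<close> in that iteration. The state after \<open>k\<close> iterations consists of the points written
  \<open>x\<close>-bar, \<open>x\<close>-tilde (index \<open>k\<close>) and the number of oracle calls made so far.
\<close>

record 'a catalyst_state =
  xbar :: 'a
  xtilde :: 'a
  calls :: nat

definition prox_centre :: "real \<Rightarrow> 'a::real_vector catalyst_state \<Rightarrow> 'a" where
  "prox_centre \<gamma> st = \<gamma> *\<^sub>R xbar st + (1 - \<gamma>) *\<^sub>R xtilde st"

primrec catalyst_sgd ::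
  "'a::euclidean_space set \<Rightarrow> ('a \<Rightarrow> 's \<Rightarrow> 'a) \<Rightarrow> real \<Rightarrow>
   (nat \<Rightarrow> real) \<Rightarrow> (nat \<Rightarrow> real) \<Rightarrow> (nat \<Rightarrow> real) \<Rightarrow> (nat \<Rightarrow> nat \<Rightarrow> real) \<Rightarrow> nat \<Rightarrow>
   (nat \<Rightarrow> nat \<Rightarrow> 's) \<Rightarrow> 'a \<Rightarrow> nat \<Rightarrow> 'a catalyst_state"
where
  "catalyst_sgd X G \<mu> \<gamma> \<beta> \<alpha> \<eta> T s x\<^sub>0 0 = \<lparr>xbar = x\<^sub>0, xtilde = x\<^sub>0, calls = 0\<rparr>"
| "catalyst_sgd X G \<mu> \<gamma> \<beta> \<alpha> \<eta> T s x\<^sub>0 (Suc j) =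
    (let st = catalyst_sgd X G \<mu> \<gamma> \<beta> \<alpha> \<eta> T s x\<^sub>0 j;
         k = Suc j;
         (xt, x, n) = sgd X G (\<beta> k) (prox_centre (\<gamma> k) st) (\<eta> k) T (s k)
     in \<lparr>xbar = (1 / (\<alpha> k * \<gamma> k + \<mu> * (1 - \<gamma> k))) *\<^sub>R
                  (\<alpha> k *\<^sub>R x + ((\<mu> - \<alpha> k) * (1 - \<gamma> k)) *\<^sub>R xtilde st),
         xtilde = xt,
         calls = calls st + n\<rparr>)"

text \<open>
  The prescribed values of \<open>K\<close> and \<open>T\<close>, rounded up to integers; \<open>R\<close> is the distance of the initial
  point to the minimizer. The value of \<open>T\<close> is computed from the rounded \<open>K\<close>.
\<close>

definition catalyst_K :: "real \<Rightarrow> real \<Rightarrow> real \<Rightarrow> nat" where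
  "catalyst_K L R \<epsilon> = nat \<lceil>4 * sqrt (L * R\<^sup>2 / \<epsilon>)\<rceil>"

definition catalyst_T :: "real \<Rightarrow> real \<Rightarrow> real \<Rightarrow> real \<Rightarrow> nat" where
  "catalyst_T L \<sigma> R \<epsilon> = nat \<lceil>8 + 32 * \<sigma>\<^sup>2 * real (catalyst_K L R \<epsilon>) / (L * \<epsilon>)\<rceil>"

end

theory Submission
  imports Defs
begin

text \<open>
  The proximal subproblem of iteration \<open>k\<close> is compared not with its own solution but with the moving
  point \<open>y = \<gamma> x\<^sup>* + (1 - \<gamma>) xtilde\<close>. The prox centre and the last SGD iterate differ from \<open>y\<close> by
  \<open>\<gamma>\<close> times the error of \<open>xbar\<close> before and after the iteration, so that the strongly convex SGD bound
  for \<open>y\<close>, multiplied by \<open>k (k + 1)\<close>, telescopes to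
  \<open>K (K + 1) (f(xtilde\<^sub>K) - f(x\<^sup>*)) \<le> 2 L R\<^sup>2 / (1 - \<Lambda>\<^sub>T) + noise\<close> along every trajectory. The part of the
  noise that is linear in the oracle errors has mean zero, because iterates and comparison point
  depend on earlier samples only; the quadratic part is controlled by the variance.

  The stepsizes \<open>2 / (\<beta> (t + 8))\<close> generate \<open>\<Lambda>\<^sub>t = 56 / ((t + 7) (t + 8))\<close>, and this is the value the
  analysis uses; the value \<open>90 / ((T + 9) (T + 10))\<close> prescribed for \<open>\<alpha>\<close> is immaterial since \<open>\<alpha>\<close>
  cancels in the update of \<open>xbar\<close> when \<open>\<mu> = 0\<close>.
\<close>

subsection \<open>Proximal steps\<close>

text \<open>Expand \<open>0 \<le> \<parallel>e d + q\<parallel>\<^sup>2\<close>. The free factor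
  \<open>e\<close> tunes how much of \<open>\<parallel>q\<parallel>\<^sup>2\<close> is
  spent.\<close>

lemma inner_ge_young:
  fixes d q :: "'a::real_inner"
  shows "- (e * (d \<bullet> q)) \<le> (e\<^sup>2 * (norm d)\<^sup>2 + (norm q)\<^sup>2) / 2"
  using zero_le_power2[of "norm (e *\<^sub>R d + q)"]
  by (simp only: power2_norm_eq_inner inner_add_left inner_add_right inner_scaleR_left
      inner_scaleR_right inner_commute[of q d]) (simp add: power2_eq_square distrib_left)

text \<open>Completing the square turns the objective into a positive multiple of the squared
  distance to \<open>u - \<eta> g\<close>, plus a constant.\<close>

lemma prox_step_eq_closest_point:
  assumes "\<eta> > 0"
  shows "prox_step X \<eta> g u = closest_point X (u - \<eta> *\<^sub>R g)"
proof -
  have obj: "g \<bullet> v + 1 / (2 * \<eta>) * (norm (v - u))\<^sup>2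
      = 1 / (2 * \<eta>) * (dist (u - \<eta> *\<^sub>R g) v)\<^sup>2 + (g \<bullet> u - \<eta> / 2 * (norm g)\<^sup>2)" for v
    using assms
    by (simp add: dist_norm power2_norm_eq_inner inner_diff_left inner_diff_right inner_add_left inner_add_right
        inner_commute field_simps)
  have less: "g \<bullet> y + 1 / (2 * \<eta>) * (norm (y - u))\<^sup>2 < g \<bullet> x + 1 / (2 * \<eta>) * (norm (x - u))\<^sup>2
      \<longleftrightarrow> dist (u - \<eta> *\<^sub>R g) y < dist (u - \<eta> *\<^sub>R g) x" for x y
  proof -
    have "(dist (u - \<eta> *\<^sub>R g) y)\<^sup>2 < (dist (u - \<eta> *\<^sub>R g) x)\<^sup>2
      \<longleftrightarrow> dist (u - \<eta> *\<^sub>R g) y < dist (u - \<eta> *\<^sub>R g) x"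
      by (meson linorder_not_le power2_le_imp_le power_mono zero_le_dist)
    then show ?thesis
      unfolding obj using assms by (simp add: divide_less_cancel)
  qed
  show ?thesis
    \<comment> \<open>\<open>arg_min_on\<close> and \<open>closest_point\<close> are both choices by
      \<open>Eps\<close>, so it suffices that their predicates coincide.\<close>
    unfolding prox_step_def arg_min_on_def arg_min_def is_arg_min_def closest_point_def less
    by (intro arg_cong[where f = Eps] ext) (auto simp: not_less)
qed

lemma prox_step_in:
  assumes "closed X" "X \<noteq> {}" "\<eta> > 0"
  shows "prox_step X \<eta> g u \<in> X"
  using assms by (simp add: prox_step_eq_closest_point closest_point_in_set)

text \<open>The step is a projection onto \<open>X\<close> and \<open>u\<close> lies in
  \<open>X\<close>, so at the projected point the directions to the unprojected point and to
  \<open>u\<close> form no acute angle. Expanding that inner product gives the estimate.\<close>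

lemma prox_step_three_point:
  assumes "closed X" "convex X" "\<eta> > 0" "u \<in> X"
  defines "p \<equiv> \<lambda>g v. prox_step X \<eta> g v"
  shows "\<eta> * (g \<bullet> (p g v - u)) + (norm (p g v - v))\<^sup>2 / 2
    \<le> (norm (v - u))\<^sup>2 / 2 - (norm (p g v - u))\<^sup>2 / 2"
proof -
  have "(v - \<eta> *\<^sub>R g - p g v) \<bullet> (u - p g v) \<le> 0"
    unfolding p_def prox_step_eq_closest_point[OF assms(3)]
    by (rule closest_point_dot) (use assms in auto)
  then show ?thesis
    by (simp add: power2_norm_eq_inner inner_diff_left inner_diff_right inner_add_left
        inner_add_right inner_commute field_simps)
qed

subsection \<open>Trajectories of SGD\<close>

text \<open>\<open>xbar\<close> arises by extrapolation, so the prox centres, where SGD starts, can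
  leave \<open>X\<close>. Hence convexity and smoothness are posed on a convex set \<open>D\<close>
  that may be larger, while minimality refers to \<open>X\<close>. \<open>f'\<close> enters through
  the smoothness inequality alone.\<close>

locale smooth_convex_min =
  fixes X D :: "'a::euclidean_space set" and f :: "'a \<Rightarrow> real" and f' :: "'a \<Rightarrow> 'a"
    and L :: real and xs :: 'a
  assumes closed_X: "closed X" and convex_X: "convex X"
    and convex_D: "convex D" and X_sub_D: "X \<subseteq> D"
    and convex_f: "strongly_convex_with 0 D f"
    and smooth_f: "smooth_with L D f f'" and L_pos: "L > 0"
    and arg_min: "is_arg_min f (\<lambda>x. x \<in> X) xs"
begin

lemma xs_in: "xs \<in> X" and xs_le: "x \<in> X \<Longrightarrow> f xs \<le> f x"
  using arg_min by (auto simp: is_arg_min_def not_less)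

lemma f_convex_on: "convex_on D f"
proof (rule convex_onI)
  show "f ((1 - t) *\<^sub>R x + t *\<^sub>R y) \<le> (1 - t) * f x + t * f y"
    if "0 < t" "t < 1" "x \<in> D" "y \<in> D" for t x y
    using convex_f[unfolded strongly_convex_with_def, rule_format, OF that(3,4), of "1 - t"] that
    by simp
qed (rule convex_D)

lemma f_upper: "x \<in> D \<Longrightarrow> y \<in> D \<Longrightarrow> f y \<le> f x + f' x \<bullet> (y - x) + L / 2 * (norm (y - x))\<^sup>2"
  using smooth_f unfolding smooth_with_def by (smt (verit) norm_minus_commute)

lemma f_lower: "x \<in> D \<Longrightarrow> y \<in> D \<Longrightarrow> f x + f' x \<bullet> (y - x) - L / 2 * (norm (y - x))\<^sup>2 \<le> f y"
  using smooth_f unfolding smooth_with_def by (smt (verit) norm_minus_commute)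

text \<open>On the segment from \<open>x\<close> to \<open>y\<close>, convexity bounds
  \<open>f\<close> above linearly in \<open>t\<close>, and smoothness bounds it below by the tangent
  up to \<open>t\<^sup>2 b\<close>. A positive defect \<open>a\<close> would thus satisfy
  \<open>a \<le> t b\<close> for all \<open>t\<close> in (0,1].\<close>

lemma f_above_tangent:
  assumes "x \<in> D" "y \<in> D"
  shows "f x + f' x \<bullet> (y - x) \<le> f y"
proof (rule ccontr)
  define a where "a = f x + f' x \<bullet> (y - x) - f y"
  define b where "b = L / 2 * (norm (y - x))\<^sup>2"
  assume "\<not> ?thesis"
  then have a: "a > 0" by (simp add: a_def)
  have b: "b \<ge> 0" using L_pos by (simp add: b_def)
  have bound: "a \<le> t * b" if t: "0 < t" "t \<le> 1" for t
  proof -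
    let ?z = "(1 - t) *\<^sub>R x + t *\<^sub>R y"
    have z: "?z \<in> D" using convex_D assms t by (simp add: convex_alt)
    have zx: "?z - x = t *\<^sub>R (y - x)" by (simp add: algebra_simps)
    have "f x + f' x \<bullet> (?z - x) - L / 2 * (norm (?z - x))\<^sup>2 \<le> f ?z"
      by (rule f_lower) fact+
    then have "f x + t * (f' x \<bullet> (y - x)) - t * (t * b) \<le> f ?z"
      unfolding zx using t by (simp add: b_def power_mult_distrib power2_eq_square mult_ac)
    also have "\<dots> \<le> (1 - t) * f x + t * f y"
      using convex_onD[OF f_convex_on, of t x y] assms t by auto
    finally have "t * a \<le> t * (t * b)"
      by (simp add: a_def algebra_simps)
    then show ?thesis using t by simp
  qed
  \<comment> \<open>This \<open>t\<close> makes \<open>t b\<close> at most \<open>a / 2\<close>; the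
    1 added to \<open>b\<close> keeps the denominator positive when \<open>b = 0\<close>.\<close>
  have "a \<le> min 1 (a / (2 * (b + 1))) * b"
    using a b by (intro bound) auto
  also have "\<dots> \<le> a / (2 * (b + 1)) * b"
    using b by (intro mult_right_mono) auto
  also have "\<dots> \<le> a / 2"
    using a b by (simp add: field_simps)
  finally show False using a by simp
qed

text \<open>Expanding the quadratic around \<open>v\<close>, the gradient of \<open>\<phi>\<close> at \<open>v\<close> is \<open>f' v + \<beta> (v - c)\<close>;
  Young's inequality absorbs the part of the noise that is correlated with \<open>p\<close>.\<close>
lemma prox_sgd_step:
  fixes g c :: 'a
  assumes v: "v \<in> D" and u: "u \<in> X" and \<eta>: "\<eta> > 0" "\<eta> * (L + \<beta>) \<le> 1 / 2"
  defines "\<phi> \<equiv> \<lambda>w. f w + \<beta> / 2 * (norm (w - c))\<^sup>2"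
  defines "p \<equiv> prox_step X \<eta> (g + \<beta> *\<^sub>R (v - c)) v"
  defines "d \<equiv> g - f' v"
  shows "\<eta> * (\<phi> p - \<phi> u) + (norm (p - u))\<^sup>2 / 2
    \<le> (1 - \<eta> * \<beta>) * ((norm (v - u))\<^sup>2 / 2) - \<eta> * (d \<bullet> (v - u)) + \<eta>\<^sup>2 * (norm d)\<^sup>2"
proof -
  have p: "p \<in> X" unfolding p_def by (rule prox_step_in) (use closed_X u \<eta> in auto)
  have "f p \<le> f v + f' v \<bullet> (p - v) + L / 2 * (norm (p - v))\<^sup>2"
    using p X_sub_D v by (intro f_upper) auto
  moreover have "f v + f' v \<bullet> (u - v) \<le> f u"
    using u X_sub_D v by (intro f_above_tangent) auto
  ultimately have "f p - f u \<le> f' v \<bullet> (p - u) + L / 2 * (norm (p - v))\<^sup>2"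
    by (simp add: inner_diff_right)
  moreover have "\<beta> / 2 * (norm (p - c))\<^sup>2 - \<beta> / 2 * (norm (u - c))\<^sup>2
      = \<beta> * ((v - c) \<bullet> (p - u)) + \<beta> / 2 * (norm (p - v))\<^sup>2 - \<beta> / 2 * (norm (v - u))\<^sup>2"
    by (simp add: power2_norm_eq_inner inner_diff_left inner_diff_right inner_add_left
        inner_add_right inner_commute field_simps)
  ultimately have "\<phi> p - \<phi> u \<le> (g + \<beta> *\<^sub>R (v - c)) \<bullet> (p - u) - d \<bullet> (p - u)
      + (L + \<beta>) / 2 * (norm (p - v))\<^sup>2 - \<beta> / 2 * (norm (v - u))\<^sup>2"
    by (simp add: \<phi>_def d_def inner_add_left inner_diff_left field_simps)
  then have "\<eta> * (\<phi> p - \<phi> u) \<le> \<eta> * ((g + \<beta> *\<^sub>R (v - c)) \<bullet> (p - u) - d \<bullet> (p - u)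
      + (L + \<beta>) / 2 * (norm (p - v))\<^sup>2 - \<beta> / 2 * (norm (v - u))\<^sup>2)"
    using \<eta> by simp
  moreover have "\<eta> * ((g + \<beta> *\<^sub>R (v - c)) \<bullet> (p - u)) + (norm (p - v))\<^sup>2 / 2
      \<le> (norm (v - u))\<^sup>2 / 2 - (norm (p - u))\<^sup>2 / 2"
    unfolding p_def using closed_X convex_X \<eta>(1) u by (rule prox_step_three_point)
  \<comment> \<open>The three-point inequality supplies half of
    \<open>\<parallel>p - v\<parallel>\<^sup>2\<close>. By the stepsize condition the curvature
    terms use at most a quarter; Young's inequality with factor \<open>2 * \<eta>\<close> uses the
    other quarter.\<close>
  moreover have "\<eta> * (L + \<beta>) * (norm (p - v))\<^sup>2 \<le> 1 / 2 * (norm (p - v))\<^sup>2"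
    using \<eta> by (intro mult_right_mono) auto
  moreover have "- (\<eta> * (d \<bullet> (p - v))) \<le> \<eta>\<^sup>2 * (norm d)\<^sup>2 + (norm (p - v))\<^sup>2 / 4"
    using inner_ge_young[of "2 * \<eta>" d "p - v"] by (simp add: power_mult_distrib)
  moreover have "\<eta> * ((g + \<beta> *\<^sub>R (v - c)) \<bullet> (p - u) - d \<bullet> (p - u)
      + (L + \<beta>) / 2 * (norm (p - v))\<^sup>2 - \<beta> / 2 * (norm (v - u))\<^sup>2)
    = \<eta> * ((g + \<beta> *\<^sub>R (v - c)) \<bullet> (p - u)) - \<eta> * (d \<bullet> (p - v)) - \<eta> * (d \<bullet> (v - u))
      + \<eta> * (L + \<beta>) * (norm (p - v))\<^sup>2 / 2 - \<eta> * \<beta> * ((norm (v - u))\<^sup>2 / 2)"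
  proof -
    have "d \<bullet> (p - u) = d \<bullet> (p - v) + d \<bullet> (v - u)"
      by (simp add: inner_diff_right)
    then show ?thesis
      by (simp only: distrib_left right_diff_distrib) (simp add: distrib_left distrib_right mult.assoc)
  qed
  ultimately show ?thesis
    by (simp only: left_diff_distrib)
qed

end

abbreviation sgd_iter where
  "sgd_iter X G \<beta> c \<eta> s t \<equiv> fst (sgd_state X G \<beta> c \<eta> s t)"

lemma sgd_iter_Suc:
  "sgd_iter X G \<beta> c \<eta> s (Suc t) = prox_step X (\<eta> (Suc t))
    (G (sgd_iter X G \<beta> c \<eta> s t) (s t) + \<beta> *\<^sub>R (sgd_iter X G \<beta> c \<eta> s t - c))
    (sgd_iter X G \<beta> c \<eta> s t)"
  by (simp add: Let_def split_beta)

lemma sgd_calls: "snd (sgd_state X G \<beta> c \<eta> s t) = t"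
  by (induction t) (auto simp: Let_def split_beta)

declare sgd_state.simps(2) [simp del]

definition sgd_noise where
  "sgd_noise f' \<eta> u v g t =
    - \<eta> (Suc t) * ((g - f' v) \<bullet> (v - u)) + (\<eta> (Suc t))\<^sup>2 * (norm (g - f' v))\<^sup>2"

text \<open>By the recursion each weight is the difference of consecutive values of
  \<open>1 / sgd_Lambda\<close>, so the sum telescopes. This normalizes the SGD average.\<close>

lemma sum_sgd_Lambda_weights:
  assumes "\<And>t. t \<le> n \<Longrightarrow> sgd_Lambda \<eta> \<mu> t \<noteq> 0"
  shows "(\<Sum>t<n. \<eta> (Suc t) * \<mu> / sgd_Lambda \<eta> \<mu> (Suc t)) = 1 / sgd_Lambda \<eta> \<mu> n - 1"
  using assms
proof (induction n)
  case (Suc n)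
  have "sgd_Lambda \<eta> \<mu> n \<noteq> 0" "sgd_Lambda \<eta> \<mu> (Suc n) \<noteq> 0"
    using Suc.prems by (simp_all del: sgd_Lambda.simps)
  then have "1 / sgd_Lambda \<eta> \<mu> n = (1 - \<eta> (Suc n) * \<mu>) / sgd_Lambda \<eta> \<mu> (Suc n)"
    by auto
  then show ?case
    using Suc by (simp del: sgd_Lambda.simps add: diff_divide_distrib)
qed simp

context smooth_convex_min
begin

context
  fixes G :: "'a \<Rightarrow> 's \<Rightarrow> 'a" and \<beta> :: real and c :: 'a and \<eta> :: "nat \<Rightarrow> real" and T :: nat
    and s :: "nat \<Rightarrow> 's"
  assumes c: "c \<in> D" and \<beta>: "\<beta> > 0"
    and \<eta>: "\<And>t. t \<in> {1..T} \<Longrightarrow> \<eta> t > 0" "\<And>t. t \<in> {1..T} \<Longrightarrow> \<eta> t * (L + \<beta>) \<le> 1 / 2"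
begin

private abbreviation "U \<equiv> sgd_iter X G \<beta> c \<eta> s"
private abbreviation "\<Lambda> \<equiv> sgd_Lambda \<eta> \<beta>"
private abbreviation "N u t \<equiv> sgd_noise f' \<eta> u (U t) (G (U t) (s t)) t"
private abbreviation "\<phi> w \<equiv> f w + \<beta> / 2 * (norm (w - c))\<^sup>2"

lemma sgd_iter_Suc_in: "t < T \<Longrightarrow> U (Suc t) \<in> X"
  unfolding sgd_iter_Suc using closed_X xs_in \<eta>(1)[of "Suc t"] by (intro prox_step_in) auto

lemma sgd_iter_in: "t \<le> T \<Longrightarrow> U t \<in> D"
  using sgd_iter_Suc_in[of "t - 1"] X_sub_D c by (cases t) auto

lemma sgd_step:
  assumes "t < T" "u \<in> X"
  shows "\<eta> (Suc t) * (\<phi> (U (Suc t)) - \<phi> u) + (norm (U (Suc t) - u))\<^sup>2 / 2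
    \<le> (1 - \<eta> (Suc t) * \<beta>) * ((norm (U t - u))\<^sup>2 / 2) + N u t"
  using prox_sgd_step[where v = "U t" and u = u and \<eta> = "\<eta> (Suc t)" and \<beta> = \<beta>
      and g = "G (U t) (s t)" and c = c] assms sgd_iter_in[of t]
    \<eta>[of "Suc t"]
  by (simp add: sgd_iter_Suc sgd_noise_def)

lemma sgd_stepsize_less_1: "t < T \<Longrightarrow> \<eta> (Suc t) * \<beta> < 1"
proof -
  assume "t < T"
  then have "\<eta> (Suc t) * \<beta> \<le> \<eta> (Suc t) * (L + \<beta>)"
    using \<eta>(1)[of "Suc t"] L_pos by (intro mult_left_mono) auto
  then show ?thesis using \<eta>(2)[of "Suc t"] \<open>t < T\<close> by auto
qed

lemma sgd_Lambda_pos: "t \<le> T \<Longrightarrow> \<Lambda> t > 0"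
  by (induction t) (auto simp: sgd_stepsize_less_1)

text \<open>Every factor is below 1, and \<open>T > 0\<close> provides at least one. The
  normalization \<open>1 - \<Lambda> T\<close> of the average is therefore positive.\<close>

lemma sgd_Lambda_less_1:
  assumes "T > 0" shows "\<Lambda> T < 1"
proof -
  have "\<Lambda> t \<le> 1" if "t \<le> T" for t
    using that
  proof (induction t)
    case (Suc t)
    have "\<Lambda> (Suc t) \<le> 1 * \<Lambda> t"
      unfolding sgd_Lambda.simps using Suc.prems sgd_Lambda_pos[of t] \<eta>(1)[of "Suc t"] \<beta>
      by (intro mult_right_mono) auto
    then show ?case using Suc by simp
  qed simp
  moreover obtain t where t: "T = Suc t" using assms not0_implies_Suc by blast
  ultimately have "\<Lambda> t \<le> 1" "\<Lambda> t > 0" using sgd_Lambda_pos[of t] by auto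
  moreover have "\<Lambda> T < 1 * \<Lambda> t"
    unfolding t sgd_Lambda.simps using \<open>\<Lambda> t > 0\<close> t \<eta>(1)[of "Suc t"] \<beta>
    by (intro mult_strict_right_mono) auto
  ultimately show ?thesis by simp
qed

text \<open>Dividing the step inequality by \<open>\<Lambda> (Suc t)\<close> turns its contraction
  factor into \<open>1 / \<Lambda> t\<close>, so the weighted distances to \<open>u\<close>
  telescope.\<close>

lemma sgd_telescope:
  assumes "n \<le> T" "u \<in> X"
  shows "(\<Sum>t<n. \<eta> (Suc t) / \<Lambda> (Suc t) * (\<phi> (U (Suc t)) - \<phi> u)) + (norm (U n - u))\<^sup>2 / (2 * \<Lambda> n)
    \<le> (norm (c - u))\<^sup>2 / 2 + (\<Sum>t<n. N u t / \<Lambda> (Suc t))"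
  using assms(1)
proof (induction n)
  case (Suc n)
  have pos: "\<Lambda> n > 0" "\<Lambda> (Suc n) > 0"
    using sgd_Lambda_pos[of n] sgd_Lambda_pos[of "Suc n"] Suc.prems by auto
  have "(\<eta> (Suc n) * (\<phi> (U (Suc n)) - \<phi> u) + (norm (U (Suc n) - u))\<^sup>2 / 2) / \<Lambda> (Suc n)
      \<le> ((1 - \<eta> (Suc n) * \<beta>) * ((norm (U n - u))\<^sup>2 / 2) + N u n) / \<Lambda> (Suc n)"
    using sgd_step[of n u] assms(2) Suc.prems pos by (intro divide_right_mono) auto
  also have "\<dots> = (norm (U n - u))\<^sup>2 / (2 * \<Lambda> n) + N u n / \<Lambda> (Suc n)"
    using sgd_stepsize_less_1[of n] Suc.prems pos by (simp add: add_divide_distrib)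
  finally have "\<eta> (Suc n) / \<Lambda> (Suc n) * (\<phi> (U (Suc n)) - \<phi> u)
      + (norm (U (Suc n) - u))\<^sup>2 / (2 * \<Lambda> (Suc n))
      \<le> (norm (U n - u))\<^sup>2 / (2 * \<Lambda> n) + N u n / \<Lambda> (Suc n)"
    by (simp add: add_divide_distrib del: sgd_Lambda.simps)
  then show ?case
    using Suc.IH Suc.prems by (simp del: sgd_Lambda.simps)
qed simp

text \<open>The weights of the output average are nonnegative and sum to 1, so Jensen's inequality
  transfers the telescoped bound to \<open>xt\<close>. The distance of the last iterate to
  \<open>u\<close> is kept, because it becomes the new error of \<open>xbar\<close>.\<close>

lemma sgd_average:
  assumes T: "T > 0" and u: "u \<in> X"
  defines "xt \<equiv> fst (sgd X G \<beta> c \<eta> T s)"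
  shows "xt \<in> X" (is ?mem)
    and "f xt - \<phi> u + \<beta> / (2 * (1 - \<Lambda> T)) * (norm (U T - u))\<^sup>2
      \<le> \<beta> * \<Lambda> T / (1 - \<Lambda> T) * ((norm (c - u))\<^sup>2 / 2 + (\<Sum>t<T. N u t / \<Lambda> (Suc t)))" (is ?bound)
proof -
  \<comment> \<open>With this scale the weights \<open>q \<eta> / \<Lambda>\<close> are exactly
    those of the output average.\<close>
  define q where "q = \<beta> * \<Lambda> T / (1 - \<Lambda> T)"
  define a where "a t = q * (\<eta> (Suc t) / \<Lambda> (Suc t))" for t
  note T_Lambda = sgd_Lambda_pos[of T] sgd_Lambda_less_1[OF T]
  have q: "q > 0" using T_Lambda \<beta> by (simp add: q_def)
  have a_nonneg: "a t \<ge> 0" if "t < T" for t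
    unfolding a_def using that q \<eta>(1)[of "Suc t"] sgd_Lambda_pos[of "Suc t"]
    by (intro mult_nonneg_nonneg divide_nonneg_nonneg less_imp_le) auto
  have "(\<Sum>t<T. a t) = \<Lambda> T / (1 - \<Lambda> T) * (\<Sum>t<T. \<eta> (Suc t) * \<beta> / \<Lambda> (Suc t))"
    by (simp add: a_def q_def sum_distrib_left mult_ac del: sgd_Lambda.simps)
  also have "\<dots> = 1"
    using T_Lambda sgd_Lambda_pos
    by (subst sum_sgd_Lambda_weights) (auto simp: less_imp_neq[symmetric] field_simps)
  finally have a_sum: "(\<Sum>t<T. a t) = 1" .
  have xt: "xt = (\<Sum>t<T. a t *\<^sub>R U (Suc t))"
    unfolding xt_def sgd_def Let_def fst_conv a_def q_def
    by (simp add: sum.atLeast1_atMost_eq scaleR_sum_right mult_ac del: sgd_Lambda.simps)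
  show ?mem
    unfolding xt using a_sum a_nonneg sgd_iter_Suc_in convex_X by (intro convex_sum) auto
  have "f xt \<le> (\<Sum>t<T. a t * f (U (Suc t)))"
    unfolding xt using a_sum a_nonneg sgd_iter_Suc_in X_sub_D f_convex_on T
    by (intro convex_on_sum) auto
  \<comment> \<open>The nonnegative prox term is given away at the iterates; at the comparison point
    \<open>u\<close> it stays.\<close>
  also have "\<dots> \<le> (\<Sum>t<T. a t * \<phi> (U (Suc t)))"
    using a_nonneg \<beta> by (intro sum_mono mult_left_mono) auto
  finally have "f xt - \<phi> u \<le> (\<Sum>t<T. a t * \<phi> (U (Suc t))) - (\<Sum>t<T. a t) * \<phi> u"
    using a_sum by simp
  also have "\<dots> = q * (\<Sum>t<T. \<eta> (Suc t) / \<Lambda> (Suc t) * (\<phi> (U (Suc t)) - \<phi> u))"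
    by (simp add: a_def sum_distrib_left sum_distrib_right right_diff_distrib sum_subtractf mult_ac
        del: sgd_Lambda.simps)
  finally have "f xt - \<phi> u + q * ((norm (U T - u))\<^sup>2 / (2 * \<Lambda> T))
      \<le> q * ((norm (c - u))\<^sup>2 / 2 + (\<Sum>t<T. N u t / \<Lambda> (Suc t)))"
    using mult_left_mono[OF sgd_telescope[OF order_refl u], of q] q
    by (simp only: distrib_left) linarith
  moreover have "q * ((norm (U T - u))\<^sup>2 / (2 * \<Lambda> T)) = \<beta> / (2 * (1 - \<Lambda> T)) * (norm (U T - u))\<^sup>2"
    using T_Lambda by (simp add: q_def)
  ultimately show ?bound by (simp only: q_def)
qed

end

end

subsection \<open>Trajectories of Catalyst\<close>

text \<open>The factor of step \<open>i\<close> is \<open>(i + 6) / (i + 8)\<close>. The product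
  cancels up to two factors at each end, and 56 is 7 times 8.\<close>

lemma sgd_Lambda_eq:
  assumes "\<beta> > 0" "\<And>i. i \<in> {1..T} \<Longrightarrow> \<eta> i = 2 / (\<beta> * (real i + 8))" "t \<le> T"
  shows "sgd_Lambda \<eta> \<beta> t = 56 / ((real t + 7) * (real t + 8))"
  using assms(3)
proof (induction t)
  case (Suc t)
  have "1 - \<eta> (Suc t) * \<beta> = (real t + 7) / (real t + 9)"
    using assms(1) assms(2)[of "Suc t"] Suc.prems by (simp add: diff_divide_eq_iff add_ac)
  moreover have "real (Suc t) + 7 = real t + 8" "real (Suc t) + 8 = real t + 9"
    by simp_all
  moreover have "sgd_Lambda \<eta> \<beta> t = 56 / ((real t + 7) * (real t + 8))"
    using Suc by simp
  ultimately show ?case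
    unfolding sgd_Lambda.simps by (simp only:) (simp add: divide_simps)
qed simp

locale catalyst_sgd_setup = smooth_convex_min X D f f' L xs
  for X D :: "'a::euclidean_space set" and f f' L xs +
  fixes G :: "'a \<Rightarrow> 's \<Rightarrow> 'a"
    and \<gamma> \<beta> \<alpha> :: "nat \<Rightarrow> real" and \<eta> :: "nat \<Rightarrow> nat \<Rightarrow> real"
    and K T :: nat and x0 :: 'a
  assumes gamma: "k \<in> {1..K} \<Longrightarrow> \<gamma> k = 2 / (real k + 1)"
    and beta: "k \<in> {1..K} \<Longrightarrow> \<beta> k = (real k + 1) * L / real k"
    and alpha: "k \<in> {1..K} \<Longrightarrow> \<alpha> k \<noteq> 0"
    and eta: "k \<in> {1..K} \<Longrightarrow> t \<in> {1..T} \<Longrightarrow> \<eta> k t = 2 / (\<beta> k * (real t + 8))"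
    and x0: "x0 \<in> X" and T_pos: "T > 0"
begin

definition st :: "(nat \<Rightarrow> nat \<Rightarrow> 's) \<Rightarrow> nat \<Rightarrow> 'a catalyst_state" where
  "st s = catalyst_sgd X G 0 \<gamma> \<beta> \<alpha> \<eta> T s x0"

text \<open>Iteration \<open>k\<close> starts from the state with index \<open>k - 1\<close>.
  Iterations are numbered from 1, so the truncated subtraction at \<open>k = 0\<close> has no
  meaning.\<close>

definition centre where "centre s k = prox_centre (\<gamma> k) (st s (k - 1))"

definition iter where "iter s k = sgd_iter X G (\<beta> k) (centre s k) (\<eta> k) (s k)"

definition target where "target s k = \<gamma> k *\<^sub>R xs + (1 - \<gamma> k) *\<^sub>R xtilde (st s (k - 1))"

definition err where "err s k t = G (iter s k t) (s k t) - f' (iter s k t)"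

definition Lambda :: "nat \<Rightarrow> real" where "Lambda t = 56 / ((real t + 7) * (real t + 8))"

text \<open>This is \<open>sgd_noise\<close> taken against the moving comparison point
  \<open>target s k\<close>.\<close>

definition noise where
  "noise s k t = - \<eta> k (Suc t) * (err s k t \<bullet> (iter s k t - target s k))
    + (\<eta> k (Suc t))\<^sup>2 * (norm (err s k t))\<^sup>2"

lemma st_0: "st s 0 = \<lparr>xbar = x0, xtilde = x0, calls = 0\<rparr>"
  by (simp add: st_def)

lemma st_Suc:
  "st s (Suc j) = \<lparr>
    xbar = (1 / (\<alpha> (Suc j) * \<gamma> (Suc j))) *\<^sub>R (\<alpha> (Suc j) *\<^sub>R iter s (Suc j) T
      - (\<alpha> (Suc j) * (1 - \<gamma> (Suc j))) *\<^sub>R xtilde (st s j)),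
    xtilde = fst (sgd X G (\<beta> (Suc j)) (centre s (Suc j)) (\<eta> (Suc j)) T (s (Suc j))),
    calls = calls (st s j) + T\<rparr>"
  unfolding st_def catalyst_sgd.simps iter_def centre_def
  by (simp add: Let_def split_beta sgd_def sgd_calls st_def)

lemma calls_eq: "calls (st s k) = k * T"
  by (induction k) (auto simp: st_0 st_Suc)

lemma gamma_pos: "k \<in> {1..K} \<Longrightarrow> \<gamma> k > 0"
  and gamma_le_1: "k \<in> {1..K} \<Longrightarrow> \<gamma> k \<le> 1"
  and beta_gt: "k \<in> {1..K} \<Longrightarrow> \<beta> k > L"
  and eta_pos: "k \<in> {1..K} \<Longrightarrow> t \<in> {1..T} \<Longrightarrow> \<eta> k t > 0"
  and eta_le: "k \<in> {1..K} \<Longrightarrow> t \<in> {1..T} \<Longrightarrow> \<eta> k t * (L + \<beta> k) \<le> 1 / 2"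
proof -
  assume k: "k \<in> {1..K}"
  show "\<gamma> k > 0" "\<gamma> k \<le> 1" using k by (auto simp: gamma)
  show *: "\<beta> k > L" using k L_pos by (simp add: beta field_simps)
  assume t: "t \<in> {1..T}"
  show "\<eta> k t > 0" using eta[OF k t] * L_pos by simp
  \<comment> \<open>The stepsize condition reads
    \<open>4 (L + \<beta>) \<le> \<beta> (t + 8)\<close>. Since \<open>L < \<beta>\<close>, the
    offset 8 already covers the left side.\<close>
  have "0 \<le> \<beta> k * real t" using * L_pos by simp
  then have "4 * L + 4 * \<beta> k \<le> \<beta> k * (real t + 8)"
    unfolding distrib_left using * by linarith
  then show "\<eta> k t * (L + \<beta> k) \<le> 1 / 2"
    using * L_pos by (simp add: eta[OF k t] pos_divide_le_eq)
qed

lemma beta_pos: "k \<in> {1..K} \<Longrightarrow> \<beta> k > 0"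
  using beta_gt L_pos by fastforce

lemma Lambda_eq: "k \<in> {1..K} \<Longrightarrow> t \<le> T \<Longrightarrow> sgd_Lambda (\<eta> k) (\<beta> k) t = Lambda t"
  unfolding Lambda_def by (rule sgd_Lambda_eq) (use beta_pos eta in auto)

lemma iter_0: "iter s k 0 = centre s k"
  by (simp add: iter_def)

lemma iter_Suc:
  "iter s k (Suc t) = prox_step X (\<eta> k (Suc t))
    (G (iter s k t) (s k t) + \<beta> k *\<^sub>R (iter s k t - centre s k)) (iter s k t)"
  by (simp add: iter_def sgd_iter_Suc)

text \<open>\<open>xtilde\<close> averages SGD iterates with positive index. These are projections
  onto \<open>X\<close>, even when the centre lies outside \<open>X\<close>.\<close>

lemma xtilde_in:
  assumes "\<And>i. i \<in> {1..k} \<Longrightarrow> centre s i \<in> D" "k \<le> K"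
  shows "xtilde (st s k) \<in> X"
proof (cases k)
  case (Suc j)
  then show ?thesis
    unfolding Suc st_Suc catalyst_state.simps
    using Suc assms beta_pos eta_pos eta_le T_pos xs_in by (intro sgd_average(1)) auto
qed (simp add: st_0 x0)

text \<open>\<open>\<alpha>\<close> cancels. Subtracting \<open>\<gamma> xs\<close> on both sides
  shows that the last iterate misses \<open>target\<close> by \<open>\<gamma>\<close> times the
  error of the new \<open>xbar\<close>.\<close>

lemma xbar_Suc:
  assumes "Suc j \<le> K"
  shows "\<gamma> (Suc j) *\<^sub>R xbar (st s (Suc j)) = iter s (Suc j) T - (1 - \<gamma> (Suc j)) *\<^sub>R xtilde (st s j)"
proof -
  have "\<alpha> (Suc j) \<noteq> 0" "\<gamma> (Suc j) \<noteq> 0"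
    using alpha[of "Suc j"] gamma_pos[of "Suc j"] assms by auto
  then show ?thesis
    unfolding st_Suc by (simp add: scaleR_diff_right)
qed

text \<open>Apply \<open>sgd_average\<close> with \<open>u = target s k\<close>. Convexity of
  \<open>f\<close> at this point produces the factor \<open>1 - \<gamma> k\<close>, and both
  distances become \<open>\<gamma> k\<close> times errors of \<open>xbar\<close>.\<close>

lemma catalyst_step:
  assumes centre: "\<And>i. i \<in> {1..Suc j} \<Longrightarrow> centre s i \<in> D" and j: "Suc j \<le> K"
  defines "k \<equiv> Suc j"
  defines "a \<equiv> \<beta> k * (\<gamma> k)\<^sup>2 / (2 * (1 - Lambda T))"
  shows "f (xtilde (st s k)) - f xs + a * (norm (xbar (st s k) - xs))\<^sup>2
    \<le> (1 - \<gamma> k) * (f (xtilde (st s j)) - f xs) + a * (norm (xbar (st s j) - xs))\<^sup>2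
      + \<beta> k * Lambda T / (1 - Lambda T) * (\<Sum>t<T. noise s k t / Lambda (Suc t))"
proof -
  have k: "k \<in> {1..K}" using j by (auto simp: k_def)
  note \<gamma> = gamma_pos[OF k] gamma_le_1[OF k]
  let ?y = "target s k"
  have xt: "xtilde (st s j) \<in> X" using centre j by (intro xtilde_in) auto
  have y: "?y \<in> X"
    unfolding target_def using \<gamma> xs_in xt convex_X by (simp add: k_def convex_def)
  have fy: "f ?y \<le> \<gamma> k * f xs + (1 - \<gamma> k) * f (xtilde (st s j))"
    using convex_onD[OF f_convex_on, of "1 - \<gamma> k" xs "xtilde (st s j)"] \<gamma> xt xs_in X_sub_D
    by (auto simp: target_def k_def)
  have sgd_iter: "sgd_iter X G (\<beta> k) (centre s k) (\<eta> k) (s k) t = iter s k t" for t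
    by (simp add: iter_def)
  have xt_eq: "fst (sgd X G (\<beta> k) (centre s k) (\<eta> k) T (s k)) = xtilde (st s k)"
    by (simp add: k_def st_Suc)
  have sums: "(\<Sum>t<T. sgd_noise f' (\<eta> k) ?y (iter s k t) (G (iter s k t) (s k t)) t /
        sgd_Lambda (\<eta> k) (\<beta> k) (Suc t)) = (\<Sum>t<T. noise s k t / Lambda (Suc t))"
    using Lambda_eq[OF k]
    by (intro sum.cong) (auto simp: sgd_noise_def noise_def err_def simp del: sgd_Lambda.simps)
  have "f (fst (sgd X G (\<beta> k) (centre s k) (\<eta> k) T (s k)))
      - (f ?y + \<beta> k / 2 * (norm (?y - centre s k))\<^sup>2)
      + \<beta> k / (2 * (1 - sgd_Lambda (\<eta> k) (\<beta> k) T))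
        * (norm (sgd_iter X G (\<beta> k) (centre s k) (\<eta> k) (s k) T - ?y))\<^sup>2
      \<le> \<beta> k * sgd_Lambda (\<eta> k) (\<beta> k) T / (1 - sgd_Lambda (\<eta> k) (\<beta> k) T)
        * ((norm (centre s k - ?y))\<^sup>2 / 2
          + (\<Sum>t<T. sgd_noise f' (\<eta> k) ?y (sgd_iter X G (\<beta> k) (centre s k) (\<eta> k) (s k) t)
              (G (sgd_iter X G (\<beta> k) (centre s k) (\<eta> k) (s k) t) (s k t)) t
              / sgd_Lambda (\<eta> k) (\<beta> k) (Suc t)))"
    by (rule sgd_average(2))
      (use centre[of k] beta_pos[OF k] eta_pos[OF k] eta_le[OF k] T_pos y in \<open>auto simp: k_def\<close>)
  note this[unfolded sgd_iter sums Lambda_eq[OF k order_refl] xt_eq]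
  moreover have "centre s k - ?y = \<gamma> k *\<^sub>R (xbar (st s j) - xs)"
    by (simp add: centre_def target_def prox_centre_def k_def scaleR_diff_right)
  then have "(norm (centre s k - ?y))\<^sup>2 = (\<gamma> k)\<^sup>2 * (norm (xbar (st s j) - xs))\<^sup>2"
    "(norm (?y - centre s k))\<^sup>2 = (\<gamma> k)\<^sup>2 * (norm (xbar (st s j) - xs))\<^sup>2"
    by (simp_all add: norm_minus_commute[of ?y] power_mult_distrib)
  moreover have "iter s k T - ?y = \<gamma> k *\<^sub>R (xbar (st s k) - xs)"
    using xbar_Suc[OF j, of s] by (simp add: target_def k_def scaleR_diff_right)
  then have "(norm (iter s k T - ?y))\<^sup>2 = (\<gamma> k)\<^sup>2 * (norm (xbar (st s k) - xs))\<^sup>2"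
    by (simp add: power_mult_distrib)
  ultimately have "f (xtilde (st s k)) - (f ?y + \<beta> k / 2 * ((\<gamma> k)\<^sup>2 * (norm (xbar (st s j) - xs))\<^sup>2))
      + a * (norm (xbar (st s k) - xs))\<^sup>2
      \<le> \<beta> k * Lambda T / (1 - Lambda T) * ((\<gamma> k)\<^sup>2 * (norm (xbar (st s j) - xs))\<^sup>2 / 2)
        + \<beta> k * Lambda T / (1 - Lambda T) * (\<Sum>t<T. noise s k t / Lambda (Suc t))"
    by (simp add: a_def distrib_left)
  \<comment> \<open>The old error of \<open>xbar\<close> enters twice: through the initial distance
    of SGD and through the prox term at the comparison point. As
    \<open>\<Lambda> / (1 - \<Lambda>) + 1 = 1 / (1 - \<Lambda>)\<close>, it ends with the same
    coefficient \<open>a\<close> as the new error.\<close>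
  moreover have "\<beta> k * Lambda T / (1 - Lambda T) * (Z / 2) + \<beta> k / 2 * Z = \<beta> k / (2 * (1 - Lambda T)) * Z" for Z
  proof -
    have "Lambda T < 1" using T_pos by (simp add: Lambda_def field_simps add_pos_pos)
    then show ?thesis by (simp add: field_simps)
  qed
  from this[of "(\<gamma> k)\<^sup>2 * (norm (xbar (st s j) - xs))\<^sup>2"]
  have "\<beta> k * Lambda T / (1 - Lambda T) * ((\<gamma> k)\<^sup>2 * (norm (xbar (st s j) - xs))\<^sup>2 / 2)
      + \<beta> k / 2 * ((\<gamma> k)\<^sup>2 * (norm (xbar (st s j) - xs))\<^sup>2) = a * (norm (xbar (st s j) - xs))\<^sup>2"
    by (simp add: a_def)
  ultimately show ?thesis
    using fy by (simp add: algebra_simps)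
qed

text \<open>Weighting step \<open>k\<close> by \<open>k (k + 1)\<close> makes both the gaps and the
  distances telescope. The initial gap \<open>f x0 - f xs\<close> disappears because its weight is
  0.\<close>

lemma catalyst_bound:
  assumes "\<And>i. i \<in> {1..n} \<Longrightarrow> centre s i \<in> D" "n \<le> K"
  shows "real n * (real n + 1) * (f (xtilde (st s n)) - f xs)
      + 2 * L / (1 - Lambda T) * (norm (xbar (st s n) - xs))\<^sup>2
    \<le> 2 * L / (1 - Lambda T) * (norm (x0 - xs))\<^sup>2
      + (\<Sum>k=1..n. real k * (real k + 1) * (\<beta> k * Lambda T / (1 - Lambda T)) *
          (\<Sum>t<T. noise s k t / Lambda (Suc t)))"
  using assms
proof (induction n)
  case 0
  then show ?case by (simp add: st_0)
next
  case (Suc n)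
  let ?k = "Suc n" and ?A = "2 * L / (1 - Lambda T)"
  let ?S = "\<Sum>t<T. noise s ?k t / Lambda (Suc t)" and ?b = "\<beta> ?k * Lambda T / (1 - Lambda T)"
  define w where "w = real ?k * (real ?k + 1)"
  have k: "?k \<in> {1..K}" using Suc.prems by simp
  \<comment> \<open>The weight turns \<open>1 - \<gamma>\<close> into the weight of the preceding
    step and makes the distance coefficient independent of the iteration.\<close>
  have w: "w * (1 - \<gamma> ?k) = real n * (real n + 1)"
    "w * (\<beta> ?k * (\<gamma> ?k)\<^sup>2) = 4 * L"
    unfolding w_def gamma[OF k] beta[OF k] by (simp_all add: divide_simps power2_eq_square)
  then have "w * (\<beta> ?k * (\<gamma> ?k)\<^sup>2 / (2 * (1 - Lambda T))) = 4 * L / (2 * (1 - Lambda T))"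
    by (simp only: times_divide_eq_right)
  moreover have "4 * L / (2 * x) = 2 * L / x" for x
    by simp
  ultimately have w2: "w * (\<beta> ?k * (\<gamma> ?k)\<^sup>2 / (2 * (1 - Lambda T))) = ?A"
    by metis
  have "w \<ge> 0" by (simp add: w_def)
  note mult_left_mono[OF catalyst_step[OF Suc.prems] this]
  then have "w * (f (xtilde (st s ?k)) - f xs) + ?A * (norm (xbar (st s ?k) - xs))\<^sup>2
      \<le> real n * (real n + 1) * (f (xtilde (st s n)) - f xs)
        + ?A * (norm (xbar (st s n) - xs))\<^sup>2 + w * ?b * ?S"
    unfolding w(1)[symmetric] w2[symmetric] by (simp only: distrib_left mult.assoc)
  also have "\<dots> \<le> ?A * (norm (x0 - xs))\<^sup>2
      + (\<Sum>k=1..n. real k * (real k + 1) * (\<beta> k * Lambda T / (1 - Lambda T)) *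
          (\<Sum>t<T. noise s k t / Lambda (Suc t))) + w * ?b * ?S"
    using Suc by (intro add_right_mono Suc.IH) auto
  finally show ?case by (simp add: w_def)
qed

end

subsection \<open>Independence of the past and oracle errors\<close>

text \<open>The sigma-algebra generated by the samples with index in \<open>P\<close>, packed as a
  measure so that dependence on the past can be expressed by \<open>measurable\<close>.\<close>

definition history :: "'w measure \<Rightarrow> 's measure \<Rightarrow> ('i \<Rightarrow> 'w \<Rightarrow> 's) \<Rightarrow> 'i set \<Rightarrow> 'w measure" where
  "history M S Z P = sigma (space M) (\<Union>i\<in>P. {Z i -` A \<inter> space M | A. A \<in> sets S})"

lemma space_history [simp]: "space (history M S Z P) = space M"
  unfolding history_def by (rule space_measure_of) auto

lemma sets_history:
  "sets (history M S Z P) = sigma_sets (space M) (\<Union>i\<in>P. {Z i -` A \<inter> space M | A. A \<in> sets S})"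
  unfolding history_def by (rule sets_measure_of) auto

lemma measurable_history_mono:
  assumes "P \<subseteq> Q" "Y \<in> measurable (history M S Z P) N"
  shows "Y \<in> measurable (history M S Z Q) N"
proof -
  have "sets (history M S Z P) \<subseteq> sets (history M S Z Q)"
    unfolding sets_history using assms(1) by (intro sigma_sets_mono') auto
  then show ?thesis using assms(2) by (auto simp: measurable_def)
qed

lemma measurable_history_sample:
  assumes "i \<in> P" "Z i \<in> measurable M S"
  shows "Z i \<in> measurable (history M S Z P) S"
proof (rule measurableI)
  show "Z i \<omega> \<in> space S" if "\<omega> \<in> space (history M S Z P)" for \<omega>
    using measurable_space[OF assms(2)] that by simp
  show "Z i -` A \<inter> space (history M S Z P) \<in> sets (history M S Z P)" if "A \<in> sets S" for A
    unfolding sets_history space_history using assms(1) that by (intro sigma_sets.Basic) auto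
qed

lemma measurable_history_imp:
  assumes "\<And>i. i \<in> P \<Longrightarrow> Z i \<in> measurable M S" "Y \<in> measurable (history M S Z P) N"
  shows "Y \<in> measurable M N"
proof -
  have "sets (history M S Z P) \<subseteq> sets M"
    unfolding sets_history by (rule sets.sigma_sets_subset) (use assms(1) in \<open>auto intro: measurable_sets\<close>)
  then show ?thesis using assms(2) by (auto simp: measurable_def)
qed

context prob_space
begin

text \<open>Independence as factorization of the joint law, which is the form needed for Fubini's
  theorem. The two variables may have values of different types.\<close>

definition indep_pair :: "'n measure \<Rightarrow> ('a \<Rightarrow> 'n) \<Rightarrow> 's measure \<Rightarrow> ('a \<Rightarrow> 's) \<Rightarrow> bool" where
  "indep_pair N Y S Z \<longleftrightarrow> Y \<in> measurable M N \<and> Z \<in> measurable M S \<and>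
    distr M (N \<Otimes>\<^sub>M S) (\<lambda>\<omega>. (Y \<omega>, Z \<omega>)) = distr M N Y \<Otimes>\<^sub>M distr M S Z"

lemma indep_pair_rv1: "indep_pair N Y S Z \<Longrightarrow> Y \<in> measurable M N"
  by (simp add: indep_pair_def)

lemma indep_pair_rv2: "indep_pair N Y S Z \<Longrightarrow> Z \<in> measurable M S"
  by (simp add: indep_pair_def)

text \<open>A function of the samples in \<open>P\<close> is independent of a sample outside
  \<open>P\<close>. This is the source of all later conditioning on the past.\<close>

lemma indep_pair_history:
  assumes indep: "indep_vars (\<lambda>_. S) Z I" and P: "P \<subseteq> I" and i: "i \<in> I" "i \<notin> P"
    and Y: "Y \<in> measurable (history M S Z P) N"
  shows "indep_pair N Y S (Z i)"
proof -
  let ?E = "\<lambda>i. {Z i -` A \<inter> space M | A. A \<in> sets S}"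
  have Z: "\<And>i. i \<in> I \<Longrightarrow> Z i \<in> measurable M S" and E: "indep_sets ?E I"
    using indep unfolding indep_vars_def2 by auto
  have Int: "Int_stable (?E j)" for j
  proof (rule Int_stableI, clarify)
    fix A B assume "A \<in> sets S" "B \<in> sets S"
    then show "\<exists>C. Z j -` A \<inter> space M \<inter> (Z j -` B \<inter> space M) = Z j -` C \<inter> space M \<and> C \<in> sets S"
      by (intro exI[of _ "A \<inter> B"]) auto
  qed
  \<comment> \<open>The samples are grouped into two blocks, \<open>P\<close> and
    \<open>{i}\<close>. Disjoint blocks of independent, intersection-stable families generate
    independent sigma-algebras.\<close>
  have "indep_sets ?E (\<Union>b\<in>UNIV. case_bool P {i} b)"
    by (rule indep_sets_mono_index[OF _ E]) (use P i in \<open>auto split: bool.splits\<close>)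
  then have "indep_sets (\<lambda>b. sigma_sets (space M) (\<Union>j\<in>case_bool P {i} b. ?E j)) UNIV"
    by (rule indep_sets_collect_sigma)
      (use Int i in \<open>auto simp: disjoint_family_on_def split: bool.splits\<close>)
  then have "indep_set (sigma_sets (space M) (\<Union>j\<in>P. ?E j)) (sigma_sets (space M) (?E i))"
    unfolding indep_set_def by (rule indep_sets_mono_sets) (auto split: bool.splits)
  then have ind: "prob (A \<inter> B) = prob A * prob B"
    if "A \<in> sigma_sets (space M) (\<Union>j\<in>P. ?E j)" "B \<in> sigma_sets (space M) (?E i)" for A B
    using that by (simp only: indep_sets2_eq)
  have Y_M[measurable]: "Y \<in> measurable M N"
    using Y by (rule measurable_history_imp[rotated]) (use Z P in auto)
  note [measurable] = Z[OF i(1)]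
  interpret Y: prob_space "distr M N Y" by (rule prob_space_distr) simp
  interpret Z: prob_space "distr M S (Z i)" by (rule prob_space_distr) simp
  \<comment> \<open>The joint law is determined by its values on rectangles, where independence
    gives the product.\<close>
  have "distr M N Y \<Otimes>\<^sub>M distr M S (Z i) = distr M (N \<Otimes>\<^sub>M S) (\<lambda>\<omega>. (Y \<omega>, Z i \<omega>))"
  proof (rule pair_measure_eqI)
    fix A B assume "A \<in> sets (distr M N Y)" "B \<in> sets (distr M S (Z i))"
    then have A[measurable]: "A \<in> sets N" and B[measurable]: "B \<in> sets S" by auto
    have "Y -` A \<inter> space M \<in> sigma_sets (space M) (\<Union>j\<in>P. ?E j)"
      using measurable_sets[OF Y A] by (simp add: sets_history)
    moreover have "Z i -` B \<inter> space M \<in> sigma_sets (space M) (?E i)"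
      using B by (intro sigma_sets.Basic) auto
    ultimately have "prob ((Y -` A \<inter> space M) \<inter> (Z i -` B \<inter> space M))
        = prob (Y -` A \<inter> space M) * prob (Z i -` B \<inter> space M)"
      by (rule ind)
    moreover have "(\<lambda>\<omega>. (Y \<omega>, Z i \<omega>)) -` (A \<times> B) \<inter> space M
        = (Y -` A \<inter> space M) \<inter> (Z i -` B \<inter> space M)" by auto
    ultimately show "emeasure (distr M N Y) A * emeasure (distr M S (Z i)) B
        = emeasure (distr M (N \<Otimes>\<^sub>M S) (\<lambda>\<omega>. (Y \<omega>, Z i \<omega>))) (A \<times> B)"
      by (simp add: emeasure_distr emeasure_eq_measure ennreal_mult'')
  qed (unfold_locales, simp_all)
  then show ?thesis unfolding indep_pair_def by simp
qed

text \<open>Fubini for the joint law: \<open>Y\<close> is frozen at \<open>\<omega>\<close> while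
  \<open>Z\<close> is averaged over a fresh \<open>\<omega>'\<close>, which plays the role of
  conditioning on \<open>Y\<close>.\<close>

lemma nn_integral_indep_pair:
  assumes indep: "indep_pair N Y S Z" and h[measurable]: "h \<in> borel_measurable (N \<Otimes>\<^sub>M S)"
  shows "(\<integral>\<^sup>+\<omega>. h (Y \<omega>, Z \<omega>) \<partial>M) = (\<integral>\<^sup>+\<omega>. (\<integral>\<^sup>+\<omega>'. h (Y \<omega>, Z \<omega>') \<partial>M) \<partial>M)"
proof -
  note [measurable] = indep_pair_rv1[OF indep] indep_pair_rv2[OF indep]
  interpret Z: prob_space "distr M S Z" by (rule prob_space_distr) simp
  have "(\<integral>\<^sup>+\<omega>. h (Y \<omega>, Z \<omega>) \<partial>M) = (\<integral>\<^sup>+p. h p \<partial>(distr M N Y \<Otimes>\<^sub>M distr M S Z))"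
    by (subst indep[unfolded indep_pair_def, THEN conjunct2, THEN conjunct2, symmetric])
      (simp add: nn_integral_distr)
  also have "\<dots> = (\<integral>\<^sup>+y. (\<integral>\<^sup>+z. h (y, z) \<partial>distr M S Z) \<partial>distr M N Y)"
    by (rule Z.nn_integral_fst[symmetric]) simp
  also have "\<dots> = (\<integral>\<^sup>+\<omega>. (\<integral>\<^sup>+z. h (Y \<omega>, z) \<partial>distr M S Z) \<partial>M)"
    by (rule nn_integral_distr) simp_all
  also have "\<dots> = (\<integral>\<^sup>+\<omega>. (\<integral>\<^sup>+\<omega>'. h (Y \<omega>, Z \<omega>') \<partial>M) \<partial>M)"
    by (rule nn_integral_cong, rule nn_integral_distr)
      (use measurable_space[OF indep_pair_rv1[OF indep]] in auto)
  finally show ?thesis .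
qed

lemma integral_indep_pair:
  fixes h :: "_ \<Rightarrow> real"
  assumes indep: "indep_pair N Y S Z" and h[measurable]: "h \<in> borel_measurable (N \<Otimes>\<^sub>M S)"
    and int: "integrable M (\<lambda>\<omega>. h (Y \<omega>, Z \<omega>))"
  shows "(\<integral>\<omega>. h (Y \<omega>, Z \<omega>) \<partial>M) = (\<integral>\<omega>. (\<integral>\<omega>'. h (Y \<omega>, Z \<omega>') \<partial>M) \<partial>M)"
proof -
  note [measurable] = indep_pair_rv1[OF indep] indep_pair_rv2[OF indep]
  interpret Y: prob_space "distr M N Y" by (rule prob_space_distr) simp
  interpret Z: prob_space "distr M S Z" by (rule prob_space_distr) simp
  interpret pair_sigma_finite "distr M N Y" "distr M S Z" ..
  have eq: "distr M N Y \<Otimes>\<^sub>M distr M S Z = distr M (N \<Otimes>\<^sub>M S) (\<lambda>\<omega>. (Y \<omega>, Z \<omega>))"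
    using indep by (simp add: indep_pair_def)
  have "integrable (distr M N Y \<Otimes>\<^sub>M distr M S Z) h"
    unfolding eq by (subst integrable_distr_eq) (use int in simp_all)
  then have "(\<integral>y. (\<integral>z. h (y, z) \<partial>distr M S Z) \<partial>distr M N Y) = (\<integral>p. h p \<partial>(distr M N Y \<Otimes>\<^sub>M distr M S Z))"
    by (rule integral_fst')
  also have "\<dots> = (\<integral>\<omega>. h (Y \<omega>, Z \<omega>) \<partial>M)"
    unfolding eq by (rule integral_distr) simp_all
  finally have "(\<integral>\<omega>. h (Y \<omega>, Z \<omega>) \<partial>M) = (\<integral>y. (\<integral>z. h (y, z) \<partial>distr M S Z) \<partial>distr M N Y)" by simp
  also have "\<dots> = (\<integral>\<omega>. (\<integral>z. h (Y \<omega>, z) \<partial>distr M S Z) \<partial>M)"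
    by (rule integral_distr) simp_all
  also have "\<dots> = (\<integral>\<omega>. (\<integral>\<omega>'. h (Y \<omega>, Z \<omega>') \<partial>M) \<partial>M)"
    by (rule Bochner_Integration.integral_cong[OF refl], rule integral_distr)
      (use measurable_space[OF indep_pair_rv1[OF indep]] in auto)
  finally show ?thesis .
qed

section \<open>Square-integrable random vectors\<close>

definition sq_integrable :: "('a \<Rightarrow> 'b::euclidean_space) \<Rightarrow> bool" where
  "sq_integrable Y \<longleftrightarrow> Y \<in> borel_measurable M \<and> integrable M (\<lambda>\<omega>. (norm (Y \<omega>))\<^sup>2)"

lemma sq_integrable_const: "sq_integrable (\<lambda>_. c)"
  by (simp add: sq_integrable_def)

lemma sq_integrable_scaleR: "sq_integrable Y \<Longrightarrow> sq_integrable (\<lambda>\<omega>. c *\<^sub>R Y \<omega>)"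
  by (auto simp: sq_integrable_def power_mult_distrib)

lemma sq_integrable_add:
  assumes "sq_integrable Y" "sq_integrable Z"
  shows "sq_integrable (\<lambda>\<omega>. Y \<omega> + Z \<omega>)"
proof -
  note [measurable] = assms[unfolded sq_integrable_def, THEN conjunct1]
  have "integrable M (\<lambda>\<omega>. 2 * (norm (Y \<omega>))\<^sup>2 + 2 * (norm (Z \<omega>))\<^sup>2)"
    using assms by (auto simp: sq_integrable_def)
  then have "integrable M (\<lambda>\<omega>. (norm (Y \<omega> + Z \<omega>))\<^sup>2)"
  proof (rule Bochner_Integration.integrable_bound)
    have "(norm (a + b))\<^sup>2 \<le> 2 * (norm a)\<^sup>2 + 2 * (norm b)\<^sup>2" for a b :: 'b
      using zero_le_power2[of "norm (a - b)"]
      by (simp add: power2_norm_eq_inner inner_add_left inner_add_right inner_diff_left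
          inner_diff_right inner_commute)
    then show "AE \<omega> in M. norm ((norm (Y \<omega> + Z \<omega>))\<^sup>2) \<le> norm (2 * (norm (Y \<omega>))\<^sup>2 + 2 * (norm (Z \<omega>))\<^sup>2)"
      by simp
  qed simp
  then show ?thesis by (simp add: sq_integrable_def)
qed

lemma sq_integrable_diff:
  "sq_integrable Y \<Longrightarrow> sq_integrable Z \<Longrightarrow> sq_integrable (\<lambda>\<omega>. Y \<omega> - Z \<omega>)"
  using sq_integrable_add[of Y "\<lambda>\<omega>. (- 1) *\<^sub>R Z \<omega>"] sq_integrable_scaleR[of Z "- 1"] by simp

lemma sq_integrable_sum:
  "(\<And>i. i \<in> A \<Longrightarrow> sq_integrable (Y i)) \<Longrightarrow> sq_integrable (\<lambda>\<omega>. \<Sum>i\<in>A. Y i \<omega>)"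
  by (induction A rule: infinite_finite_induct)
    (auto intro: sq_integrable_add simp: sq_integrable_const)

lemma sq_integrable_bound:
  assumes "Y \<in> borel_measurable M" "integrable M h" "\<And>\<omega>. \<omega> \<in> space M \<Longrightarrow> (norm (Y \<omega>))\<^sup>2 \<le> h \<omega>"
  shows "sq_integrable Y"
  unfolding sq_integrable_def
proof (intro conjI Bochner_Integration.integrable_bound[OF assms(2)])
  show "AE \<omega> in M. norm ((norm (Y \<omega>))\<^sup>2) \<le> norm (h \<omega>)"
    using assms(3) by (intro AE_I2) (fastforce intro: order_trans)
qed (use assms(1) in simp_all)

lemma integrable_inner_sq_integrable:
  assumes "sq_integrable Y" "sq_integrable Z"
  shows "integrable M (\<lambda>\<omega>. Y \<omega> \<bullet> Z \<omega>)"
proof -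
  note [measurable] = assms[unfolded sq_integrable_def, THEN conjunct1]
  have "integrable M (\<lambda>\<omega>. (norm (Y \<omega>))\<^sup>2 + (norm (Z \<omega>))\<^sup>2)"
    using assms by (auto simp: sq_integrable_def)
  then show ?thesis
  proof (rule Bochner_Integration.integrable_bound)
    have "\<bar>a \<bullet> b\<bar> \<le> (norm a)\<^sup>2 + (norm b)\<^sup>2" for a b :: 'b
      using Cauchy_Schwarz_ineq2[of a b] sum_squares_bound[of "norm a" "norm b"]
        mult_nonneg_nonneg[of "norm a" "norm b"] by simp
    then show "AE \<omega> in M. norm (Y \<omega> \<bullet> Z \<omega>) \<le> norm ((norm (Y \<omega>))\<^sup>2 + (norm (Z \<omega>))\<^sup>2)"
      by simp
  qed simp
qed

section \<open>Moments of the oracle error at a random query point\<close>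

context
  fixes D :: "'c::euclidean_space set" and f' :: "'c \<Rightarrow> 'c" and \<sigma> :: real
    and G :: "'c \<Rightarrow> 's \<Rightarrow> 'c" and \<xi> :: "'a \<Rightarrow> 's" and S :: "'s measure"
  assumes sfo: "sfo_call M D f' \<sigma> G \<xi>"
    and G[measurable]: "(\<lambda>(x, s). G x s) \<in> borel_measurable (restrict_space borel D \<Otimes>\<^sub>M S)"
    and \<xi>[measurable]: "\<xi> \<in> measurable M S"
begin

text \<open>On \<open>D\<close>, \<open>f'\<close> is the mean of the oracle answers, and an
  integral of a jointly measurable function depends measurably on its parameter.\<close>

lemma borel_measurable_sfo_mean: "f' \<in> borel_measurable (restrict_space borel D)"
proof -
  have "(\<lambda>(x, \<omega>). G x (\<xi> \<omega>)) \<in> borel_measurable (restrict_space borel D \<Otimes>\<^sub>M M)"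
    using measurable_compose[OF _ G, of "\<lambda>(x, \<omega>). (x, \<xi> \<omega>)"] by (simp add: split_beta)
  then have "(\<lambda>x. \<integral>\<omega>. G x (\<xi> \<omega>) \<partial>M) \<in> borel_measurable (restrict_space borel D)"
    by (rule borel_measurable_lebesgue_integral)
  moreover have "f' x = (\<integral>\<omega>. G x (\<xi> \<omega>) \<partial>M)" if "x \<in> space (restrict_space borel D)" for x
    using sfo that by (simp add: sfo_call_def space_restrict_space)
  ultimately show ?thesis by (simp cong: measurable_cong)
qed

lemma borel_measurable_sfo_error:
  "(\<lambda>(x, s). G x s - f' x) \<in> borel_measurable (restrict_space borel D \<Otimes>\<^sub>M S)"
proof -
  have [measurable]: "(\<lambda>p. f' (fst p)) \<in> borel_measurable (restrict_space borel D \<Otimes>\<^sub>M S)"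
    by (rule measurable_compose[OF measurable_fst borel_measurable_sfo_mean])
  show ?thesis
    using G unfolding split_beta by measurable
qed

text \<open>Freezing the query point reduces the bound to the variance condition of the oracle.
  Nonnegative integrals come first, since their finiteness is what yields integrability.\<close>

lemma sfo_error_variance:
  assumes indep: "indep_pair (restrict_space borel D) Y S \<xi>"
  shows "sq_integrable (\<lambda>\<omega>. G (Y \<omega>) (\<xi> \<omega>) - f' (Y \<omega>))" (is "sq_integrable ?d")
    and "(\<integral>\<omega>. (norm (G (Y \<omega>) (\<xi> \<omega>) - f' (Y \<omega>)))\<^sup>2 \<partial>M) \<le> \<sigma>\<^sup>2"
proof -
  note Y = indep_pair_rv1[OF indep]
  have d: "?d \<in> borel_measurable M"
    using measurable_compose[OF measurable_Pair[OF Y \<xi>] borel_measurable_sfo_error] by simp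
  have "(\<integral>\<^sup>+\<omega>. ennreal ((norm (?d \<omega>))\<^sup>2) \<partial>M)
      = (\<integral>\<^sup>+\<omega>. (\<integral>\<^sup>+\<omega>'. ennreal ((norm (G (Y \<omega>) (\<xi> \<omega>') - f' (Y \<omega>)))\<^sup>2) \<partial>M) \<partial>M)"
    using nn_integral_indep_pair[OF indep, of "\<lambda>(x, s). ennreal ((norm (G x s - f' x))\<^sup>2)"]
      borel_measurable_sfo_error by (simp add: split_beta)
  also have "\<dots> \<le> (\<integral>\<^sup>+\<omega>. ennreal (\<sigma>\<^sup>2) \<partial>M)"
  proof (rule nn_integral_mono)
    fix \<omega> assume "\<omega> \<in> space M"
    then have "Y \<omega> \<in> D"
      using measurable_space[OF Y] by (simp add: space_restrict_space)
    then have "integrable M (\<lambda>\<omega>'. (norm (G (Y \<omega>) (\<xi> \<omega>') - f' (Y \<omega>)))\<^sup>2)"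
      "(\<integral>\<omega>'. (norm (G (Y \<omega>) (\<xi> \<omega>') - f' (Y \<omega>)))\<^sup>2 \<partial>M) \<le> \<sigma>\<^sup>2"
      using sfo by (auto simp: sfo_call_def dual_norm_eq_norm)
    then show "(\<integral>\<^sup>+\<omega>'. ennreal ((norm (G (Y \<omega>) (\<xi> \<omega>') - f' (Y \<omega>)))\<^sup>2) \<partial>M) \<le> ennreal (\<sigma>\<^sup>2)"
      by (subst nn_integral_eq_integral) (auto intro: ennreal_leI)
  qed
  also have "\<dots> = ennreal (\<sigma>\<^sup>2)" by (simp add: emeasure_space_1)
  finally have le: "(\<integral>\<^sup>+\<omega>. ennreal ((norm (?d \<omega>))\<^sup>2) \<partial>M) \<le> ennreal (\<sigma>\<^sup>2)" .
  then have int: "integrable M (\<lambda>\<omega>. (norm (?d \<omega>))\<^sup>2)"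
    using d by (intro integrableI_bounded) (auto intro: le_less_trans)
  then show "sq_integrable ?d" using d by (simp add: sq_integrable_def)
  show "(\<integral>\<omega>. (norm (?d \<omega>))\<^sup>2 \<partial>M) \<le> \<sigma>\<^sup>2"
    using le int by (simp add: nn_integral_eq_integral)
qed

text \<open>With the query point and \<open>V\<close> frozen, the inner mean vanishes because the
  oracle is unbiased. The square integrability of both factors justifies the exchange of
  integrals.\<close>

lemma sfo_error_uncorrelated:
  assumes indep: "indep_pair (restrict_space borel D \<Otimes>\<^sub>M borel) (\<lambda>\<omega>. (Y \<omega>, V \<omega>)) S \<xi>"
    and V: "sq_integrable V" and d: "sq_integrable (\<lambda>\<omega>. G (Y \<omega>) (\<xi> \<omega>) - f' (Y \<omega>))"
  shows "(\<integral>\<omega>. (G (Y \<omega>) (\<xi> \<omega>) - f' (Y \<omega>)) \<bullet> V \<omega> \<partial>M) = 0"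
proof -
  let ?B = "restrict_space borel D"
  let ?h = "\<lambda>((x, v), s). (G x s - f' x) \<bullet> v"
  have fst_snd: "(\<lambda>p. (fst (fst p), snd p)) \<in> measurable ((?B \<Otimes>\<^sub>M borel) \<Otimes>\<^sub>M S) (?B \<Otimes>\<^sub>M S)"
    by measurable
  have "(\<lambda>p. G (fst (fst p)) (snd p) - f' (fst (fst p)))
      \<in> borel_measurable ((?B \<Otimes>\<^sub>M borel) \<Otimes>\<^sub>M S)"
    using measurable_compose[OF fst_snd borel_measurable_sfo_error] by simp
  then have h: "?h \<in> borel_measurable ((?B \<Otimes>\<^sub>M borel) \<Otimes>\<^sub>M S)"
    unfolding split_beta by (rule borel_measurable_inner) measurable
  have "(\<integral>\<omega>. (G (Y \<omega>) (\<xi> \<omega>) - f' (Y \<omega>)) \<bullet> V \<omega> \<partial>M)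
      = (\<integral>\<omega>. (\<integral>\<omega>'. (G (Y \<omega>) (\<xi> \<omega>') - f' (Y \<omega>)) \<bullet> V \<omega> \<partial>M) \<partial>M)"
    using integral_indep_pair[OF indep h] integrable_inner_sq_integrable[OF d V] by simp
  also have "\<dots> = (\<integral>\<omega>. 0 \<partial>M)"
  proof (rule Bochner_Integration.integral_cong[OF refl])
    fix \<omega> assume "\<omega> \<in> space M"
    then have "Y \<omega> \<in> D"
      using measurable_space[OF indep_pair_rv1[OF indep]]
      by (auto simp: space_pair_measure space_restrict_space)
    then show "(\<integral>\<omega>'. (G (Y \<omega>) (\<xi> \<omega>') - f' (Y \<omega>)) \<bullet> V \<omega> \<partial>M) = 0"
      using sfo by (simp add: sfo_call_def prob_space)
  qed
  finally show ?thesis by simp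
qed

end

end

subsection \<open>The stochastic process\<close>

text \<open>
  The bound contains no gradient. This matters because \<open>f'\<close> need not grow linearly: within \<open>D\<close> it is
  determined only along the affine hull of \<open>D\<close>.
\<close>
lemma (in smooth_convex_min) sgd_iter_dist:
  fixes G :: "'a \<Rightarrow> 's \<Rightarrow> 'a" and s :: "nat \<Rightarrow> 's"
  assumes c: "c \<in> D" and \<beta>: "\<beta> > 0"
    and \<eta>: "\<And>t. t \<in> {1..T} \<Longrightarrow> \<eta> t > 0" "\<And>t. t \<in> {1..T} \<Longrightarrow> \<eta> t * (L + \<beta>) \<le> 1 / 2"
    and t: "t < T"
  defines "U \<equiv> sgd_iter X G \<beta> c \<eta> s"
  shows "(norm (U (Suc t) - xs))\<^sup>2
    \<le> 2 * (norm (U t - xs))\<^sup>2 + 3 * (\<eta> (Suc t))\<^sup>2 * (norm (G (U t) (s t) - f' (U t)))\<^sup>2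
      + \<eta> (Suc t) * \<beta> * (norm (c - xs))\<^sup>2"
proof -
  let ?e = "\<eta> (Suc t)" and ?d = "G (U t) (s t) - f' (U t)"
  have e: "?e > 0" using \<eta>(1)[of "Suc t"] t by simp
  have "f xs \<le> f (U (Suc t))"
    unfolding U_def by (intro xs_le sgd_iter_Suc_in[OF c \<beta> \<eta> t])
  moreover have "0 \<le> \<beta> / 2 * (norm (U (Suc t) - c))\<^sup>2" using \<beta> by simp
  \<comment> \<open>With \<open>xs\<close> as comparison point, minimality bounds the gap of the
    prox objective below by its prox term at \<open>xs\<close>. Young's inequality then doubles the
    distance term and turns the noise coefficient into 3.\<close>
  ultimately have "?e * (f xs - (f xs + \<beta> / 2 * (norm (c - xs))\<^sup>2))
      \<le> ?e * ((f (U (Suc t)) + \<beta> / 2 * (norm (U (Suc t) - c))\<^sup>2)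
        - (f xs + \<beta> / 2 * (norm (xs - c))\<^sup>2))"
    using e unfolding norm_minus_commute[of c xs] by (intro mult_left_mono) linarith+
  moreover have "?e * ((f (U (Suc t)) + \<beta> / 2 * (norm (U (Suc t) - c))\<^sup>2)
        - (f xs + \<beta> / 2 * (norm (xs - c))\<^sup>2)) + (norm (U (Suc t) - xs))\<^sup>2 / 2
      \<le> (1 - ?e * \<beta>) * ((norm (U t - xs))\<^sup>2 / 2)
        + sgd_noise f' \<eta> xs (U t) (G (U t) (s t)) t"
    unfolding U_def by (rule sgd_step[OF c \<beta> \<eta> t xs_in])
  moreover have "(1 - ?e * \<beta>) * ((norm (U t - xs))\<^sup>2 / 2) \<le> 1 * ((norm (U t - xs))\<^sup>2 / 2)"
    using e \<beta> by (intro mult_right_mono) auto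
  moreover have "- ?e * (?d \<bullet> (U t - xs)) \<le> (?e\<^sup>2 * (norm ?d)\<^sup>2 + (norm (U t - xs))\<^sup>2) / 2"
    using inner_ge_young[of ?e ?d "U t - xs"] by simp
  ultimately show ?thesis
    by (simp add: sgd_noise_def)
qed

text \<open>Projection onto a nonempty closed convex set is continuous.\<close>

lemma borel_measurable_prox_step:
  assumes "closed X" "convex X" "X \<noteq> {}" "\<eta> > 0"
    and g: "g \<in> borel_measurable N" and u: "u \<in> borel_measurable N"
  shows "(\<lambda>\<omega>. prox_step X \<eta> (g \<omega>) (u \<omega>)) \<in> borel_measurable N"
proof -
  have "closest_point X \<in> borel_measurable borel"
    using assms by (intro borel_measurable_continuous_onI continuous_on_closest_point)
  moreover have "(\<lambda>\<omega>. u \<omega> - \<eta> *\<^sub>R g \<omega>) \<in> borel_measurable N"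
    using g u by measurable
  ultimately show ?thesis
    unfolding prox_step_eq_closest_point[OF assms(4)] by (rule measurable_compose_rev)
qed

locale stochastic_catalyst =
  catalyst_sgd_setup X D f f' L xs G \<gamma> \<beta> \<alpha> \<eta> K T x0 + prob_space M
  for X D :: "'a::euclidean_space set" and f f' L xs and G :: "'a \<Rightarrow> 's \<Rightarrow> 'a"
    and \<gamma> \<beta> \<alpha> \<eta> K T x0 and M :: "'w measure" +
  fixes S :: "'s measure" and \<xi> :: "nat \<Rightarrow> nat \<Rightarrow> 'w \<Rightarrow> 's" and \<sigma> :: real
  assumes centre_in: "k \<in> {1..K} \<Longrightarrow> \<omega> \<in> space M \<Longrightarrow> centre (\<lambda>k t. \<xi> k t \<omega>) k \<in> D"
    and G_measurable: "(\<lambda>(x, s). G x s) \<in> borel_measurable (restrict_space borel D \<Otimes>\<^sub>M S)"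
    and indep: "indep_vars (\<lambda>_. S) (\<lambda>(k, t). \<xi> k t) ({1..K} \<times> {..<T})"
    and sfo: "k \<in> {1..K} \<Longrightarrow> t < T \<Longrightarrow> sfo_call M D f' \<sigma> G (\<xi> k t)"
    and f_continuous: "continuous_on D f"
begin

section \<open>Filtration generated by the samples\<close>

definition sample where "sample \<omega> k t = \<xi> k t \<omega>"

lemma sample_centre_in: "k \<in> {1..K} \<Longrightarrow> \<omega> \<in> space M \<Longrightarrow> centre (sample \<omega>) k \<in> D"
  using centre_in unfolding sample_def[abs_def] by simp

text \<open>Lexicographic order of the calls, strict in \<open>(k, t)\<close>: the sample of call
  \<open>(k, t)\<close> itself is excluded and remains fresh for the query made at that
  time.\<close>

definition past :: "nat \<Rightarrow> nat \<Rightarrow> (nat \<times> nat) set" where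
  "past k t = {(k', t'). k' \<in> {1..K} \<and> t' < T \<and> (k' < k \<or> k' = k \<and> t' < t)}"

lemma past_subset: "past k t \<subseteq> {1..K} \<times> {..<T}"
  by (auto simp: past_def)

definition H where "H k t = history M S (\<lambda>(k, t). \<xi> k t) (past k t)"

lemma space_H [simp]: "space (H k t) = space M"
  by (simp add: H_def)

lemma H_Suc: "Y \<in> measurable (H k t) N \<Longrightarrow> Y \<in> measurable (H k (Suc t)) N"
  unfolding H_def by (erule measurable_history_mono[rotated]) (auto simp: past_def)

lemma H_next: "Y \<in> measurable (H k t) N \<Longrightarrow> Y \<in> measurable (H (Suc k) 0) N"
  unfolding H_def by (erule measurable_history_mono[rotated]) (auto simp: past_def)

lemma H_mono: "Y \<in> measurable (H k 0) N \<Longrightarrow> Y \<in> measurable (H k t) N"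
  unfolding H_def by (erule measurable_history_mono[rotated]) (auto simp: past_def)

lemma measurable_sample: "k \<in> {1..K} \<Longrightarrow> t < T \<Longrightarrow> \<xi> k t \<in> measurable M S"
  using indep unfolding indep_vars_def by fastforce

lemma H_imp: "Y \<in> measurable (H k t) N \<Longrightarrow> Y \<in> measurable M N"
  unfolding H_def
  by (erule measurable_history_imp[rotated]) (auto simp: past_def measurable_sample)

lemma H_sample: "k \<in> {1..K} \<Longrightarrow> t < T \<Longrightarrow> \<xi> k t \<in> measurable (H k (Suc t)) S"
  unfolding H_def
  using measurable_history_sample[of "(k, t)" "past k (Suc t)" "\<lambda>(k, t). \<xi> k t"] measurable_sample
  by (simp add: past_def)

lemma H_indep:
  "k \<in> {1..K} \<Longrightarrow> t < T \<Longrightarrow> Y \<in> measurable (H k t) N \<Longrightarrow> indep_pair N Y S (\<xi> k t)"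
  unfolding H_def
  using indep_pair_history[OF indep past_subset, of "(k, t)" k t Y N] by (auto simp: past_def)

section \<open>Adaptedness of the iterates\<close>

lemma iter_in: "k \<in> {1..K} \<Longrightarrow> t \<le> T \<Longrightarrow> \<omega> \<in> space M \<Longrightarrow> iter (sample \<omega>) k t \<in> D"
  unfolding iter_def
  by (rule sgd_iter_in) (use sample_centre_in beta_pos eta_pos eta_le in auto)

text \<open>The oracle is measurable on \<open>D\<close>, so iterates must be viewed as maps into
  the restricted space before they are queried.\<close>

lemma iter_measurable_restrict:
  assumes "k \<in> {1..K}" "t \<le> T" "(\<lambda>\<omega>. iter (sample \<omega>) k t) \<in> borel_measurable (H k t)"
  shows "(\<lambda>\<omega>. iter (sample \<omega>) k t) \<in> measurable (H k t) (restrict_space borel D)"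
  using assms iter_in by (intro measurable_restrict_space2) auto

lemma iter_measurable:
  assumes k: "k \<in> {1..K}" and c: "(\<lambda>\<omega>. centre (sample \<omega>) k) \<in> borel_measurable (H k 0)"
    and "t \<le> T"
  shows "(\<lambda>\<omega>. iter (sample \<omega>) k t) \<in> borel_measurable (H k t)"
  using assms(3)
proof (induction t)
  case 0
  then show ?case using c by (simp add: iter_0)
next
  case (Suc t)
  then have t: "t < T" and iter: "(\<lambda>\<omega>. iter (sample \<omega>) k t) \<in> borel_measurable (H k t)" by auto
  have [measurable]: "(\<lambda>\<omega>. iter (sample \<omega>) k t) \<in> borel_measurable (H k (Suc t))"
    "(\<lambda>\<omega>. centre (sample \<omega>) k) \<in> borel_measurable (H k (Suc t))"
    using H_Suc[OF iter] H_mono[OF c] by auto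
  have "(\<lambda>\<omega>. (iter (sample \<omega>) k t, \<xi> k t \<omega>)) \<in> measurable (H k (Suc t)) (restrict_space borel D \<Otimes>\<^sub>M S)"
    using H_Suc[OF iter_measurable_restrict[OF k _ iter]] H_sample[OF k t] t
    by (intro measurable_Pair) auto
  from measurable_compose[OF this G_measurable]
  have [measurable]: "(\<lambda>\<omega>. G (iter (sample \<omega>) k t) (sample \<omega> k t)) \<in> borel_measurable (H k (Suc t))"
    by (simp add: sample_def)
  show ?case
    unfolding iter_Suc using closed_X convex_X xs_in eta_pos[OF k, of "Suc t"] t
    by (intro borel_measurable_prox_step) (auto, measurable)
qed

text \<open>The weights are chosen before the samples, hence deterministic. Measurability and square
  integrability therefore pass from the iterates to their average.\<close>

lemma xtilde_Suc:
  obtains w where "\<And>s. xtilde (st s (Suc j)) = (\<Sum>t<T. w t *\<^sub>R iter s (Suc j) (Suc t))"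
proof
  show "xtilde (st s (Suc j)) = (\<Sum>t<T. (sgd_Lambda (\<eta> (Suc j)) (\<beta> (Suc j)) T
      / (1 - sgd_Lambda (\<eta> (Suc j)) (\<beta> (Suc j)) T) * (\<eta> (Suc j) (Suc t) * \<beta> (Suc j)
      / sgd_Lambda (\<eta> (Suc j)) (\<beta> (Suc j)) (Suc t))) *\<^sub>R iter s (Suc j) (Suc t))" for s
    unfolding st_Suc sgd_def iter_def Let_def
    by (simp add: sum.atLeast1_atMost_eq scaleR_sum_right del: sgd_Lambda.simps)
qed

lemma centre_measurable:
  assumes "(\<lambda>\<omega>. xbar (st (sample \<omega>) j)) \<in> borel_measurable (H (Suc j) 0)"
    "(\<lambda>\<omega>. xtilde (st (sample \<omega>) j)) \<in> borel_measurable (H (Suc j) 0)"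
  shows "(\<lambda>\<omega>. centre (sample \<omega>) (Suc j)) \<in> borel_measurable (H (Suc j) 0)"
  using assms unfolding centre_def prox_centre_def by simp

lemma st_measurable:
  assumes "j \<le> K"
  shows "(\<lambda>\<omega>. xbar (st (sample \<omega>) j)) \<in> borel_measurable (H (Suc j) 0)
    \<and> (\<lambda>\<omega>. xtilde (st (sample \<omega>) j)) \<in> borel_measurable (H (Suc j) 0)"
  using assms
proof (induction j)
  case (Suc j)
  have k: "Suc j \<in> {1..K}" using Suc.prems by simp
  have st: "(\<lambda>\<omega>. xbar (st (sample \<omega>) j)) \<in> borel_measurable (H (Suc j) 0)"
    "(\<lambda>\<omega>. xtilde (st (sample \<omega>) j)) \<in> borel_measurable (H (Suc j) 0)"
    using Suc by auto
  have iter: "(\<lambda>\<omega>. iter (sample \<omega>) (Suc j) t) \<in> borel_measurable (H (Suc (Suc j)) 0)" if "t \<le> T" for t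
    using H_next[OF iter_measurable[OF k centre_measurable[OF st] that]] .
  obtain w where w: "\<And>s. xtilde (st s (Suc j)) = (\<Sum>t<T. w t *\<^sub>R iter s (Suc j) (Suc t))"
    using xtilde_Suc by blast
  have "(\<lambda>\<omega>. xtilde (st (sample \<omega>) (Suc j))) \<in> borel_measurable (H (Suc (Suc j)) 0)"
    unfolding w using iter by (intro borel_measurable_sum borel_measurable_scaleR) auto
  moreover have "(\<lambda>\<omega>. xbar (st (sample \<omega>) (Suc j))) \<in> borel_measurable (H (Suc (Suc j)) 0)"
    unfolding st_Suc catalyst_state.simps using iter[of T] H_next[OF st(2)]
    by (intro borel_measurable_scaleR borel_measurable_diff) auto
  ultimately show ?case by simp
qed (simp add: st_0)

lemma iter_adapted:
  assumes k: "k \<in> {1..K}" and t: "t \<le> T"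
  shows "(\<lambda>\<omega>. iter (sample \<omega>) k t) \<in> borel_measurable (H k t)"
proof -
  obtain j where j: "k = Suc j" using k by (cases k) auto
  then show ?thesis
    using iter_measurable[OF _ centre_measurable _, of j] st_measurable[of j] k t by auto
qed

lemma target_adapted:
  assumes k: "k \<in> {1..K}"
  shows "(\<lambda>\<omega>. target (sample \<omega>) k) \<in> borel_measurable (H k t)"
proof -
  obtain j where j: "k = Suc j" using k by (cases k) auto
  have "(\<lambda>\<omega>. xtilde (st (sample \<omega>) j)) \<in> borel_measurable (H k t)"
    unfolding j by (rule H_mono) (use st_measurable[of j] k j in auto)
  then show ?thesis unfolding target_def j by simp
qed

section \<open>Second moments and the expected noise\<close>

lemma err_sq_integrable:
  assumes k: "k \<in> {1..K}" and t: "t < T"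
  shows "sq_integrable (\<lambda>\<omega>. err (sample \<omega>) k t)"
    and "(\<integral>\<omega>. (norm (err (sample \<omega>) k t))\<^sup>2 \<partial>M) \<le> \<sigma>\<^sup>2"
proof -
  have "indep_pair (restrict_space borel D) (\<lambda>\<omega>. iter (sample \<omega>) k t) S (\<xi> k t)"
    using k t by (intro H_indep iter_measurable_restrict iter_adapted) auto
  from sfo_error_variance[OF sfo[OF k t] G_measurable measurable_sample[OF k t] this]
  show "sq_integrable (\<lambda>\<omega>. err (sample \<omega>) k t)"
    and "(\<integral>\<omega>. (norm (err (sample \<omega>) k t))\<^sup>2 \<partial>M) \<le> \<sigma>\<^sup>2"
    by (simp_all add: err_def sample_def)
qed

text \<open>The induction step is the gradient-free estimate \<open>sgd_iter_dist\<close>, whose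
  right side is integrable by the variance bound. Subtracting and restoring the constant
  \<open>xs\<close> is harmless.\<close>

lemma iter_sq_integrable:
  assumes k: "k \<in> {1..K}" and c: "sq_integrable (\<lambda>\<omega>. centre (sample \<omega>) k)"
    and "t \<le> T"
  shows "sq_integrable (\<lambda>\<omega>. iter (sample \<omega>) k t)"
  using assms(3)
proof (induction t)
  case 0
  then show ?case using c by (simp add: iter_0)
next
  case (Suc t)
  then have t: "t < T" and iter: "sq_integrable (\<lambda>\<omega>. iter (sample \<omega>) k t)" by auto
  let ?h = "\<lambda>\<omega>. 2 * (norm (iter (sample \<omega>) k t - xs))\<^sup>2
      + 3 * (\<eta> k (Suc t))\<^sup>2 * (norm (err (sample \<omega>) k t))\<^sup>2
      + \<eta> k (Suc t) * \<beta> k * (norm (centre (sample \<omega>) k - xs))\<^sup>2"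
  have "integrable M ?h"
    using sq_integrable_diff[OF iter sq_integrable_const] sq_integrable_diff[OF c sq_integrable_const]
      err_sq_integrable(1)[OF k t]
    unfolding sq_integrable_def by simp
  moreover have "(norm (iter (sample \<omega>) k (Suc t) - xs))\<^sup>2 \<le> ?h \<omega>" if "\<omega> \<in> space M" for \<omega>
    unfolding err_def iter_def
    by (rule sgd_iter_dist)
      (use that k t sample_centre_in beta_pos eta_pos eta_le in auto)
  moreover have "(\<lambda>\<omega>. iter (sample \<omega>) k (Suc t) - xs) \<in> borel_measurable M"
    using H_imp[OF iter_adapted[OF k Suc.prems]] by simp
  ultimately have "sq_integrable (\<lambda>\<omega>. iter (sample \<omega>) k (Suc t) - xs)"
    by (intro sq_integrable_bound[where h = ?h])
  from sq_integrable_add[OF this sq_integrable_const[of xs]] show ?case by simp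
qed

lemma centre_sq_integrable:
  assumes "sq_integrable (\<lambda>\<omega>. xbar (st (sample \<omega>) j))" "sq_integrable (\<lambda>\<omega>. xtilde (st (sample \<omega>) j))"
  shows "sq_integrable (\<lambda>\<omega>. centre (sample \<omega>) (Suc j))"
  unfolding centre_def prox_centre_def
  using assms by (simp add: sq_integrable_add sq_integrable_scaleR)

lemma st_sq_integrable:
  assumes "j \<le> K"
  shows "sq_integrable (\<lambda>\<omega>. xbar (st (sample \<omega>) j)) \<and> sq_integrable (\<lambda>\<omega>. xtilde (st (sample \<omega>) j))"
  using assms
proof (induction j)
  case (Suc j)
  have k: "Suc j \<in> {1..K}" using Suc.prems by simp
  have st: "sq_integrable (\<lambda>\<omega>. xbar (st (sample \<omega>) j))" "sq_integrable (\<lambda>\<omega>. xtilde (st (sample \<omega>) j))"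
    using Suc by auto
  note iter = iter_sq_integrable[OF k centre_sq_integrable[OF st]]
  obtain w where w: "\<And>s. xtilde (st s (Suc j)) = (\<Sum>t<T. w t *\<^sub>R iter s (Suc j) (Suc t))"
    using xtilde_Suc by blast
  have "sq_integrable (\<lambda>\<omega>. xtilde (st (sample \<omega>) (Suc j)))"
    unfolding w using iter by (intro sq_integrable_sum sq_integrable_scaleR) auto
  moreover have "sq_integrable (\<lambda>\<omega>. xbar (st (sample \<omega>) (Suc j)))"
    unfolding st_Suc catalyst_state.simps using iter[of T] st(2)
    by (intro sq_integrable_scaleR sq_integrable_diff) auto
  ultimately show ?case by simp
qed (simp add: st_0 sq_integrable_const)

text \<open>The displacement from \<open>target\<close> depends on the past only, so the linear part
  of the noise has mean zero. The variance bound controls the remaining quadratic part.\<close>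

lemma noise_expectation:
  assumes k: "k \<in> {1..K}" and t: "t < T"
  shows "integrable M (\<lambda>\<omega>. noise (sample \<omega>) k t)"
    and "(\<integral>\<omega>. noise (sample \<omega>) k t \<partial>M) \<le> (\<eta> k (Suc t))\<^sup>2 * \<sigma>\<^sup>2"
proof -
  let ?V = "\<lambda>\<omega>. iter (sample \<omega>) k t - target (sample \<omega>) k"
  note err = err_sq_integrable[OF k t]
  have tk: "t \<le> T" using t by simp
  obtain j where j: "k = Suc j" using k by (cases k) auto
  have st: "sq_integrable (\<lambda>\<omega>. xbar (st (sample \<omega>) j))" "sq_integrable (\<lambda>\<omega>. xtilde (st (sample \<omega>) j))"
    using st_sq_integrable[of j] k j by auto
  have V: "sq_integrable ?V"
    unfolding target_def using iter_sq_integrable[OF k _ tk] centre_sq_integrable[OF st] st(2) j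
    by (intro sq_integrable_diff sq_integrable_add sq_integrable_const sq_integrable_scaleR) auto
  have "(\<lambda>\<omega>. (iter (sample \<omega>) k t, ?V \<omega>)) \<in> measurable (H k t) (restrict_space borel D \<Otimes>\<^sub>M borel)"
    using iter_measurable_restrict[OF k tk iter_adapted[OF k tk]] iter_adapted[OF k tk]
      target_adapted[OF k, of t]
    by (intro measurable_Pair) auto
  then have "indep_pair (restrict_space borel D \<Otimes>\<^sub>M borel) (\<lambda>\<omega>. (iter (sample \<omega>) k t, ?V \<omega>)) S (\<xi> k t)"
    by (rule H_indep[OF k t])
  from sfo_error_uncorrelated[OF sfo[OF k t] G_measurable measurable_sample[OF k t] this V] err(1)
  have zero: "(\<integral>\<omega>. err (sample \<omega>) k t \<bullet> ?V \<omega> \<partial>M) = 0"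
    by (simp add: err_def sample_def)
  have int: "integrable M (\<lambda>\<omega>. err (sample \<omega>) k t \<bullet> ?V \<omega>)" "integrable M (\<lambda>\<omega>. (norm (err (sample \<omega>) k t))\<^sup>2)"
    using integrable_inner_sq_integrable[OF err(1) V] err(1) by (auto simp: sq_integrable_def)
  then show "integrable M (\<lambda>\<omega>. noise (sample \<omega>) k t)"
    unfolding noise_def by simp
  have "(\<integral>\<omega>. noise (sample \<omega>) k t \<partial>M) = (\<eta> k (Suc t))\<^sup>2 * (\<integral>\<omega>. (norm (err (sample \<omega>) k t))\<^sup>2 \<partial>M)"
    unfolding noise_def using int zero by simp
  then show "(\<integral>\<omega>. noise (sample \<omega>) k t \<partial>M) \<le> (\<eta> k (Suc t))\<^sup>2 * \<sigma>\<^sup>2"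
    using err(2) by (simp add: mult_left_mono)
qed

text \<open>The weighted gap lies between 0 and the integrable bound \<open>B\<close>, which gives
  its integrability and allows the pathwise estimate to be integrated.\<close>

lemma expected_gap:
  assumes K: "K > 0"
  shows "integrable M (\<lambda>\<omega>. f (xtilde (st (sample \<omega>) K)) - f xs)"
    and "real K * (real K + 1) * (\<integral>\<omega>. (f (xtilde (st (sample \<omega>) K)) - f xs) \<partial>M)
      \<le> 2 * L / (1 - Lambda T) * (norm (x0 - xs))\<^sup>2
        + (\<Sum>k=1..K. real k * (real k + 1) * (\<beta> k * Lambda T / (1 - Lambda T)) *
            (\<Sum>t<T. (\<eta> k (Suc t))\<^sup>2 * \<sigma>\<^sup>2 / Lambda (Suc t)))"
proof -
  let ?e = "\<lambda>\<omega>. f (xtilde (st (sample \<omega>) K)) - f xs"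
  let ?w = "\<lambda>k. real k * (real k + 1) * (\<beta> k * Lambda T / (1 - Lambda T))"
  let ?K = "real K * (real K + 1)"
  define B where "B \<omega> = 2 * L / (1 - Lambda T) * (norm (x0 - xs))\<^sup>2
      + (\<Sum>k=1..K. ?w k * (\<Sum>t<T. noise (sample \<omega>) k t / Lambda (Suc t)))" for \<omega>
  have Lambda: "Lambda T < 1" using T_pos by (simp add: Lambda_def field_simps add_pos_pos)
  have Lambda_pos: "Lambda t > 0" for t by (simp add: Lambda_def)
  have xt: "xtilde (st (sample \<omega>) K) \<in> X" if "\<omega> \<in> space M" for \<omega>
    using that sample_centre_in by (intro xtilde_in) auto
  have bound: "?K * ?e \<omega> \<le> B \<omega>" if "\<omega> \<in> space M" for \<omega>
  proof -
    have "?K * ?e \<omega> + 2 * L / (1 - Lambda T) * (norm (xbar (st (sample \<omega>) K) - xs))\<^sup>2 \<le> B \<omega>"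
      unfolding B_def using that sample_centre_in by (intro catalyst_bound) auto
    moreover have "0 \<le> 2 * L / (1 - Lambda T) * (norm (xbar (st (sample \<omega>) K) - xs))\<^sup>2"
      using Lambda L_pos by simp
    ultimately show ?thesis by linarith
  qed
  have B_int: "integrable M B"
    unfolding B_def using noise_expectation(1)
    by (intro Bochner_Integration.integrable_add Bochner_Integration.integrable_sum
        integrable_mult_right integrable_divide) auto
  \<comment> \<open>Measurability of the gap: the output has values in \<open>D\<close>, on which
    \<open>f\<close> is continuous.\<close>
  have "(\<lambda>\<omega>. xtilde (st (sample \<omega>) K)) \<in> measurable M (restrict_space borel D)"
    using H_imp[of _ "Suc K" 0] st_measurable[of K] xt X_sub_D
    by (intro measurable_restrict_space2) auto
  from measurable_compose[OF this borel_measurable_continuous_on_restrict[OF f_continuous]]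
  have e_meas: "?e \<in> borel_measurable M" by simp
  have "integrable M (\<lambda>\<omega>. ?K * ?e \<omega>)"
  proof (rule Bochner_Integration.integrable_bound[OF B_int])
    show "AE \<omega> in M. norm (?K * ?e \<omega>) \<le> norm (B \<omega>)"
    proof (rule AE_I2)
      fix \<omega> assume "\<omega> \<in> space M"
      then have "0 \<le> ?K * ?e \<omega>" "?K * ?e \<omega> \<le> B \<omega>"
        using bound xt xs_le by auto
      then show "norm (?K * ?e \<omega>) \<le> norm (B \<omega>)" by simp
    qed
  qed (use e_meas in simp)
  then have int: "integrable M (\<lambda>\<omega>. inverse ?K * (?K * ?e \<omega>))"
    by (rule integrable_mult_right)
  have inv: "inverse c * (c * x) = x" if "c > 0" for c x :: real
    using that by simp
  have K_pos: "?K > 0" using K by simp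
  from int show e_int: "integrable M ?e"
    by (simp only: inv[OF K_pos])
  have "?K * (\<integral>\<omega>. ?e \<omega> \<partial>M) = (\<integral>\<omega>. ?K * ?e \<omega> \<partial>M)"
    using e_int by simp
  also have "\<dots> \<le> (\<integral>\<omega>. B \<omega> \<partial>M)"
    using e_int B_int bound by (intro integral_mono) auto
  also have "\<dots> = 2 * L / (1 - Lambda T) * (norm (x0 - xs))\<^sup>2
      + (\<Sum>k=1..K. ?w k * (\<Sum>t<T. (\<integral>\<omega>. noise (sample \<omega>) k t \<partial>M) / Lambda (Suc t)))"
  proof -
    have inner: "has_bochner_integral M (\<lambda>\<omega>. \<Sum>t<T. noise (sample \<omega>) k t / Lambda (Suc t))
        (\<Sum>t<T. (\<integral>\<omega>. noise (sample \<omega>) k t \<partial>M) / Lambda (Suc t))" if "k \<in> {1..K}" for k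
      using noise_expectation(1)[OF that]
      by (intro has_bochner_integral_sum has_bochner_integral_divide_zero
          has_bochner_integral_integrable) auto
    have const: "has_bochner_integral M (\<lambda>_. 2 * L / (1 - Lambda T) * (norm (x0 - xs))\<^sup>2)
        (2 * L / (1 - Lambda T) * (norm (x0 - xs))\<^sup>2)"
      by (simp add: has_bochner_integral_iff prob_space)
    have "has_bochner_integral M B (2 * L / (1 - Lambda T) * (norm (x0 - xs))\<^sup>2
      + (\<Sum>k=1..K. ?w k * (\<Sum>t<T. (\<integral>\<omega>. noise (sample \<omega>) k t \<partial>M) / Lambda (Suc t))))"
      unfolding B_def
      by (intro has_bochner_integral_add[OF const] has_bochner_integral_sum
          has_bochner_integral_mult_right inner)
    then show ?thesis by (rule has_bochner_integral_integral_eq)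
  qed
  also have "\<dots> \<le> 2 * L / (1 - Lambda T) * (norm (x0 - xs))\<^sup>2
      + (\<Sum>k=1..K. ?w k * (\<Sum>t<T. (\<eta> k (Suc t))\<^sup>2 * \<sigma>\<^sup>2 / Lambda (Suc t)))"
    using noise_expectation(2) Lambda Lambda_pos
    by (intro add_left_mono sum_mono mult_left_mono divide_right_mono mult_nonneg_nonneg
        divide_nonneg_nonneg less_imp_le[OF beta_pos] less_imp_le[OF Lambda_pos]) auto
  finally show "?K * (\<integral>\<omega>. ?e \<omega> \<partial>M) \<le> \<dots>" .
qed

end

subsection \<open>Parameters and complexity\<close>

text \<open>The factor \<open>56 / (T (T + 15))\<close> meets \<open>T\<close> summands of size at
  most \<open>\<sigma>\<^sup>2 / (14 \<beta>\<^sup>2)\<close>. The noise per iteration thus decays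
  like \<open>1 / T\<close>, and \<open>(k + 1) / \<beta> = k / L\<close> removes
  \<open>\<beta>\<close>.\<close>

lemma (in catalyst_sgd_setup) noise_weight_le:
  assumes k: "k \<in> {1..K}"
  shows "real k * (real k + 1) * (\<beta> k * Lambda T / (1 - Lambda T)) *
      (\<Sum>t<T. (\<eta> k (Suc t))\<^sup>2 * \<sigma>\<^sup>2 / Lambda (Suc t)) \<le> 4 * \<sigma>\<^sup>2 * (real K)\<^sup>2 / (L * real T)"
proof -
  note b = beta_pos[OF k]
  have Lambda_T: "Lambda T / (1 - Lambda T) = 56 / (real T * (real T + 15))"
  proof -
    have "1 - Lambda T = (real T * (real T + 15)) / ((real T + 7) * (real T + 8))"
      by (simp add: Lambda_def divide_simps) (simp add: algebra_simps)
    then show ?thesis by (simp add: Lambda_def)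
  qed
  have "(\<eta> k (Suc t))\<^sup>2 * \<sigma>\<^sup>2 / Lambda (Suc t) \<le> \<sigma>\<^sup>2 / (14 * (\<beta> k)\<^sup>2)" if "t < T" for t
  proof -
    have "\<eta> k (Suc t) = 2 / (\<beta> k * (real t + 9))"
      using eta[OF k, of "Suc t"] that by simp
    then have "(\<eta> k (Suc t))\<^sup>2 / Lambda (Suc t)
        = 4 / ((\<beta> k)\<^sup>2 * (real t + 9)\<^sup>2) * ((real t + 8) * (real t + 9) / 56)"
      by (simp add: Lambda_def power_divide power_mult_distrib add_ac)
    also have "\<dots> = (real t + 8) / (real t + 9) * (1 / (14 * (\<beta> k)\<^sup>2))"
      using b by (simp add: power2_eq_square divide_simps)
    also have "\<dots> \<le> 1 * (1 / (14 * (\<beta> k)\<^sup>2))"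
      by (intro mult_right_mono) auto
    finally have "(\<eta> k (Suc t))\<^sup>2 / Lambda (Suc t) * \<sigma>\<^sup>2 \<le> 1 / (14 * (\<beta> k)\<^sup>2) * \<sigma>\<^sup>2"
      by (intro mult_right_mono) auto
    then show ?thesis by simp
  qed
  then have "(\<Sum>t<T. (\<eta> k (Suc t))\<^sup>2 * \<sigma>\<^sup>2 / Lambda (Suc t)) \<le> (\<Sum>t<T. \<sigma>\<^sup>2 / (14 * (\<beta> k)\<^sup>2))"
    by (intro sum_mono) auto
  then have sum: "(\<Sum>t<T. (\<eta> k (Suc t))\<^sup>2 * \<sigma>\<^sup>2 / Lambda (Suc t)) \<le> real T * \<sigma>\<^sup>2 / (14 * (\<beta> k)\<^sup>2)"
    by simp
  have "real k * (real k + 1) * (\<beta> k * Lambda T / (1 - Lambda T)) *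
      (\<Sum>t<T. (\<eta> k (Suc t))\<^sup>2 * \<sigma>\<^sup>2 / Lambda (Suc t))
    \<le> real k * (real k + 1) * (\<beta> k * (56 / (real T * (real T + 15)))) * (real T * \<sigma>\<^sup>2 / (14 * (\<beta> k)\<^sup>2))"
    unfolding times_divide_eq_right[symmetric] Lambda_T
    using b sum by (intro mult_left_mono) (auto simp: mult.assoc)
  also have "\<dots> = 4 * \<sigma>\<^sup>2 * (real k)\<^sup>2 / (L * (real T + 15))"
    unfolding beta[OF k] using T_pos L_pos k by (simp add: power2_eq_square divide_simps)
  also have "\<dots> \<le> 4 * \<sigma>\<^sup>2 * (real K)\<^sup>2 / (L * real T)"
    using k T_pos L_pos by (intro frac_le mult_left_mono power_mono mult_nonneg_nonneg) auto
  finally show ?thesis .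
qed

text \<open>Both error sources are measured against \<open>K\<^sup>2 \<epsilon>\<close>: the choice
  of \<open>K\<close> limits the initial distance to a quarter, the choice of \<open>T\<close>
  limits the noise to an eighth, and division by \<open>K (K + 1)\<close> leaves less than
  \<open>\<epsilon>\<close>.\<close>

lemma (in stochastic_catalyst) expected_gap_le:
  assumes K: "K > 0" and T: "T \<ge> 8" and \<epsilon>: "\<epsilon> > 0"
    and K_ge: "real K \<ge> 4 * sqrt (L * (norm (xs - x0))\<^sup>2 / \<epsilon>)"
    and T_ge: "real T \<ge> 32 * \<sigma>\<^sup>2 * real K / (L * \<epsilon>)"
  shows "(\<integral>\<omega>. (f (xtilde (st (sample \<omega>) K)) - f xs) \<partial>M) \<le> \<epsilon>"
proof -
  let ?R = "(norm (xs - x0))\<^sup>2"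
  have Lambda: "Lambda T \<le> 1 / 2"
  proof -
    have "(8 + 7) * (8 + 8) \<le> (real T + 7) * (real T + 8)"
      using T by (intro mult_mono) auto
    then show ?thesis by (simp add: Lambda_def divide_simps)
  qed
  have "(4 * sqrt (L * ?R / \<epsilon>))\<^sup>2 \<le> (real K)\<^sup>2"
    using K_ge L_pos \<epsilon> by (intro power_mono) auto
  then have "L * ?R \<le> (real K)\<^sup>2 * \<epsilon> / 16"
    using L_pos \<epsilon> by (simp add: power_mult_distrib field_simps)
  moreover have "2 * L / (1 - Lambda T) * ?R \<le> 2 * L / (1 / 2) * ?R"
    using Lambda L_pos by (intro mult_right_mono divide_left_mono) auto
  ultimately have init: "2 * L / (1 - Lambda T) * (norm (x0 - xs))\<^sup>2 \<le> (real K)\<^sup>2 * \<epsilon> / 4"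
    by (simp add: norm_minus_commute)
  have "32 * \<sigma>\<^sup>2 * real K \<le> real T * (L * \<epsilon>)"
    using T_ge L_pos \<epsilon> by (simp add: pos_divide_le_eq)
  then have "4 * \<sigma>\<^sup>2 * real K / (L * real T) \<le> \<epsilon> / 8"
    using L_pos T by (simp add: field_simps)
  then have "(real K)\<^sup>2 * (4 * \<sigma>\<^sup>2 * real K / (L * real T)) \<le> (real K)\<^sup>2 * (\<epsilon> / 8)"
    by (intro mult_left_mono) auto
  moreover have "(\<Sum>k=1..K. real k * (real k + 1) * (\<beta> k * Lambda T / (1 - Lambda T)) *
      (\<Sum>t<T. (\<eta> k (Suc t))\<^sup>2 * \<sigma>\<^sup>2 / Lambda (Suc t)))
    \<le> (\<Sum>k=1..K. 4 * \<sigma>\<^sup>2 * (real K)\<^sup>2 / (L * real T))"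
    by (intro sum_mono noise_weight_le) auto
  moreover have "(\<Sum>k=1..K. 4 * \<sigma>\<^sup>2 * (real K)\<^sup>2 / (L * real T))
      = (real K)\<^sup>2 * (4 * \<sigma>\<^sup>2 * real K / (L * real T))"
    by simp
  ultimately have "(\<Sum>k=1..K. real k * (real k + 1) * (\<beta> k * Lambda T / (1 - Lambda T)) *
      (\<Sum>t<T. (\<eta> k (Suc t))\<^sup>2 * \<sigma>\<^sup>2 / Lambda (Suc t))) \<le> (real K)\<^sup>2 * \<epsilon> / 8"
    by linarith
  then have "real K * (real K + 1) * (\<integral>\<omega>. (f (xtilde (st (sample \<omega>) K)) - f xs) \<partial>M)
      \<le> (real K)\<^sup>2 * \<epsilon> / 4 + (real K)\<^sup>2 * \<epsilon> / 8"
    using expected_gap(2)[OF K] init by linarith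
  also have "\<dots> \<le> real K * (real K + 1) * \<epsilon>"
    using \<epsilon> by (simp add: power2_eq_square algebra_simps)
  finally show ?thesis
    using K by simp
qed

section \<open>Rounded parameters and the number of calls\<close>

lemma catalyst_K_ge: "real (catalyst_K L R \<epsilon>) \<ge> 4 * sqrt (L * R\<^sup>2 / \<epsilon>)"
  unfolding catalyst_K_def by (rule real_nat_ceiling_ge)

lemma catalyst_K_le:
  assumes "L > 0" "\<epsilon> > 0"
  shows "real (catalyst_K L R \<epsilon>) \<le> 4 * sqrt (L * R\<^sup>2 / \<epsilon>) + 1"
proof -
  have "0 \<le> 4 * sqrt (L * R\<^sup>2 / \<epsilon>)" using assms by simp
  then show ?thesis unfolding catalyst_K_def by linarith
qed

lemma catalyst_T_ge:
  "real (catalyst_T L \<sigma> R \<epsilon>) \<ge> 8 + 32 * \<sigma>\<^sup>2 * real (catalyst_K L R \<epsilon>) / (L * \<epsilon>)"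
  unfolding catalyst_T_def by (rule real_nat_ceiling_ge)

lemma catalyst_T_le:
  assumes "L > 0" "\<epsilon> > 0"
  shows "real (catalyst_T L \<sigma> R \<epsilon>) \<le> 9 + 32 * \<sigma>\<^sup>2 * real (catalyst_K L R \<epsilon>) / (L * \<epsilon>)"
proof -
  have "0 \<le> 32 * \<sigma>\<^sup>2 * real (catalyst_K L R \<epsilon>) / (L * \<epsilon>)" using assms by simp
  then show ?thesis unfolding catalyst_T_def by linarith
qed

text \<open>The bound on \<open>\<epsilon>\<close> gives \<open>1 \<le> sqrt c * q\<close>, so the
  unit lost by rounding \<open>K\<close> up is absorbed into \<open>A * q\<close>. In the noise
  part, \<open>q\<^sup>2\<close> brings a factor \<open>L\<close> that cancels the one in
  \<open>T\<close>.\<close>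

lemma catalyst_calls_le:
  assumes L: "L > 0" and \<epsilon>: "\<epsilon> > 0" and R: "R > 0" and c: "\<epsilon> \<le> c * (L * R\<^sup>2)"
  defines "A \<equiv> 4 + sqrt c"
  shows "real (catalyst_K L R \<epsilon> * catalyst_T L \<sigma> R \<epsilon>)
    \<le> (9 * A + 32 * A\<^sup>2) * (sqrt (L * R\<^sup>2 / \<epsilon>) + \<sigma>\<^sup>2 * R\<^sup>2 / \<epsilon>\<^sup>2)"
proof -
  define q where "q = sqrt (L * R\<^sup>2 / \<epsilon>)"
  define K where "K = real (catalyst_K L R \<epsilon>)"
  have q2: "q\<^sup>2 = L * R\<^sup>2 / \<epsilon>" using L \<epsilon> by (simp add: q_def)
  have q0: "q \<ge> 0" using L \<epsilon> by (simp add: q_def)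
  have "c > 0"
    using c \<epsilon> L R by (smt (verit) mult_nonneg_nonneg mult_nonpos_nonneg zero_le_power2)
  then have A: "A > 0" by (simp add: A_def add_pos_nonneg)
  have "1 \<le> c * (L * R\<^sup>2 / \<epsilon>)" using c \<epsilon> by (simp add: field_simps)
  then have "1 \<le> sqrt (c * (L * R\<^sup>2 / \<epsilon>))" by simp
  then have "1 \<le> sqrt c * q" by (simp only: q_def real_sqrt_mult)
  then have KA: "K \<le> A * q"
    using catalyst_K_le[OF L \<epsilon>, of R] by (simp add: K_def q_def A_def distrib_right)
  have "K * real (catalyst_T L \<sigma> R \<epsilon>) \<le> K * (9 + 32 * \<sigma>\<^sup>2 * K / (L * \<epsilon>))"
    using catalyst_T_le[OF L \<epsilon>] unfolding K_def by (intro mult_left_mono) auto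
  also have "\<dots> = 9 * K + 32 * \<sigma>\<^sup>2 / (L * \<epsilon>) * K\<^sup>2"
    by (simp add: power2_eq_square distrib_left)
  also have "\<dots> \<le> 9 * (A * q) + 32 * \<sigma>\<^sup>2 / (L * \<epsilon>) * (A * q)\<^sup>2"
    using KA L \<epsilon> by (intro add_mono mult_left_mono power_mono) (auto simp: K_def)
  also have "\<dots> = 9 * A * q + 32 * A\<^sup>2 * (\<sigma>\<^sup>2 * R\<^sup>2 / \<epsilon>\<^sup>2)"
  proof -
    have Aq: "(A * q)\<^sup>2 = A\<^sup>2 * (L * R\<^sup>2 / \<epsilon>)" by (simp add: power_mult_distrib q2)
    show ?thesis unfolding Aq using L \<epsilon> by (simp add: power2_eq_square)
  qed
  also have "\<dots> \<le> (9 * A + 32 * A\<^sup>2) * q + (9 * A + 32 * A\<^sup>2) * (\<sigma>\<^sup>2 * R\<^sup>2 / \<epsilon>\<^sup>2)"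
    using A q0 by (intro add_mono mult_right_mono) auto
  finally show ?thesis by (simp add: K_def q_def distrib_left)
qed

text \<open>For \<open>R > 0\<close> the rounded parameters force at least 8 calls, while the
  claimed order tends to 0 as \<open>\<epsilon>\<close> grows. The constant \<open>C\<close>
  therefore depends on a bound \<open>c\<close> for \<open>\<epsilon> / (L R\<^sup>2)\<close>, but
  on no other parameter.\<close>

theorem theorem2p1:
  fixes M :: "'w measure" and S :: "'s measure"
    and X D :: "'a::euclidean_space set"
    and f :: "'a \<Rightarrow> real" and f' :: "'a \<Rightarrow> 'a"
    and G :: "'a \<Rightarrow> 's \<Rightarrow> 'a"
    and \<xi> :: "nat \<Rightarrow> nat \<Rightarrow> 'w \<Rightarrow> 's"
    and \<mu> L \<sigma> \<epsilon> \<Lambda>T :: real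
    and \<gamma> \<beta> \<alpha> :: "nat \<Rightarrow> real" and \<eta> :: "nat \<Rightarrow> nat \<Rightarrow> real"
    and K T :: nat
    and x0 xs :: 'a
    and run :: "nat \<Rightarrow> 'w \<Rightarrow> 'a catalyst_state"
  assumes prob: "prob_space M"
    and X: "closed X" "convex X"
    and D: "convex D" "X \<subseteq> D"
    and grad: "gradient_on D f f'"
    and sconv: "strongly_convex_with \<mu> D f"
    and mu: "\<mu> = 0"
    and smooth: "smooth_with L D f f'" and L: "L > 0"
    and min: "is_arg_min f (\<lambda>x. x \<in> X) xs"
    and x0: "x0 \<in> X"
    and eps: "\<epsilon> > 0"
    and K: "K = catalyst_K L (norm (xs - x0)) \<epsilon>"
    and T: "T = catalyst_T L \<sigma> (norm (xs - x0)) \<epsilon>"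
    and LambdaT: "\<Lambda>T = 90 / ((real T + 9) * (real T + 10))"
    and gamma: "\<And>k. k \<in> {1..K} \<Longrightarrow> \<gamma> k = 2 / (real k + 1)"
    and beta: "\<And>k. k \<in> {1..K} \<Longrightarrow> \<beta> k = (real k + 1) * L / real k"
    and alpha: "\<And>k. k \<in> {1..K} \<Longrightarrow> \<alpha> k = \<beta> k / (1 - \<Lambda>T)"
    and eta: "\<And>k t. k \<in> {1..K} \<Longrightarrow> t \<in> {1..T} \<Longrightarrow> \<eta> k t = 2 / (\<beta> k * (real t + 8))"
    and run: "\<And>k \<omega>. run k \<omega> = catalyst_sgd X G \<mu> \<gamma> \<beta> \<alpha> \<eta> T (\<lambda>k t. \<xi> k t \<omega>) x0 k"
    and centres: "\<And>k \<omega>. k \<in> {1..K} \<Longrightarrow> \<omega> \<in> space M \<Longrightarrow> prox_centre (\<gamma> k) (run (k - 1) \<omega>) \<in> D"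
    and G: "(\<lambda>(x, s). G x s) \<in> borel_measurable (restrict_space borel D \<Otimes>\<^sub>M S)"
    and indep: "prob_space.indep_vars M (\<lambda>_. S) (\<lambda>(k, t). \<xi> k t) ({1..K} \<times> {..<T})"
    and sfo: "\<And>k t. k \<in> {1..K} \<Longrightarrow> t < T \<Longrightarrow> sfo_call M D f' \<sigma> G (\<xi> k t)"
  shows "integrable M (\<lambda>\<omega>. f (xtilde (run K \<omega>)) - f xs) \<and>
    (\<integral>\<omega>. (f (xtilde (run K \<omega>)) - f xs) \<partial>M) \<le> \<epsilon> \<and>
    (\<forall>\<omega>. calls (run K \<omega>) = K * T) \<and>
    (\<forall>c::real. \<exists>C>0. \<forall>L' \<sigma>' R \<epsilon>'.
       L' > 0 \<and> \<epsilon>' > 0 \<and> R \<ge> 0 \<and> (\<epsilon>' \<le> c * (L' * R\<^sup>2) \<or> R = 0) \<longrightarrow>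
         real (catalyst_K L' R \<epsilon>' * catalyst_T L' \<sigma>' R \<epsilon>')
           \<le> C * (sqrt (L' * R\<^sup>2 / \<epsilon>') + \<sigma>'\<^sup>2 * R\<^sup>2 / \<epsilon>'\<^sup>2))"
proof -
  interpret prob_space M by (rule prob)
  let ?R = "norm (xs - x0)"
  have T_ge: "real T \<ge> 8 + 32 * \<sigma>\<^sup>2 * real K / (L * \<epsilon>)"
    unfolding T K by (rule catalyst_T_ge)
  moreover have "0 \<le> 32 * \<sigma>\<^sup>2 * real K / (L * \<epsilon>)" using L eps by simp
  ultimately have T8: "T \<ge> 8" and T_ge': "real T \<ge> 32 * \<sigma>\<^sup>2 * real K / (L * \<epsilon>)" by auto
  interpret smooth_convex_min X D f f' L xs
    using X D sconv smooth L min unfolding mu by unfold_locales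
  interpret catalyst_sgd_setup X D f f' L xs G \<gamma> \<beta> \<alpha> \<eta> K T x0
  proof
    fix k assume k: "k \<in> {1..K}"
    \<comment> \<open>The denominator of \<open>\<Lambda>T\<close> is at least 110, which exceeds
      90; hence \<open>\<alpha> k\<close> is well defined and nonzero.\<close>
    have "(9 + 1) * (9 + 2) \<le> (real T + 9) * (real T + 10)"
      by (intro mult_mono) (use T8 in auto)
    then have "\<Lambda>T < 1" by (simp add: LambdaT divide_simps)
    moreover have "\<beta> k > 0" using k L by (simp add: beta)
    ultimately show "\<alpha> k \<noteq> 0" using alpha[OF k] by simp
  qed (use gamma beta eta x0 T8 in auto)
  have run_st: "run k \<omega> = st (\<lambda>k t. \<xi> k t \<omega>) k" for k \<omega>
    by (simp add: run st_def mu)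
  interpret stochastic_catalyst X D f f' L xs G \<gamma> \<beta> \<alpha> \<eta> K T x0 M S \<xi> \<sigma>
  proof
    show "centre (\<lambda>k t. \<xi> k t \<omega>) k \<in> D" if "k \<in> {1..K}" "\<omega> \<in> space M" for k \<omega>
      using centres[OF that] by (simp add: centre_def run_st)
    show "continuous_on D f"
      using grad unfolding gradient_on_def continuous_on_eq_continuous_within
      by (blast intro: has_derivative_continuous)
  qed (fact G indep sfo)+
  have run_sample: "run k \<omega> = st (sample \<omega>) k" for k \<omega>
    by (simp add: run_st sample_def[abs_def])
  have gap: "integrable M (\<lambda>\<omega>. f (xtilde (run K \<omega>)) - f xs) \<and>
      (\<integral>\<omega>. (f (xtilde (run K \<omega>)) - f xs) \<partial>M) \<le> \<epsilon>"
  proof (cases "K = 0")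
    \<comment> \<open>No iteration is run only if the starting point already is
      \<open>xs\<close>.\<close>
    case True
    then have "4 * sqrt (L * ?R\<^sup>2 / \<epsilon>) \<le> 0"
      using catalyst_K_ge[of L ?R \<epsilon>] K by simp
    then have "L * ?R\<^sup>2 / \<epsilon> \<le> 0" by simp
    then have "?R\<^sup>2 \<le> 0"
      using L eps by (simp add: divide_le_0_iff mult_le_0_iff)
    then show ?thesis using True eps by (simp add: run_st st_0)
  next
    case False
    then show ?thesis
      unfolding run_sample using T8 eps T_ge' catalyst_K_ge[of L ?R \<epsilon>] K
      by (intro conjI expected_gap(1) expected_gap_le) auto
  qed
  have complexity: "\<exists>C>0. \<forall>L' \<sigma>' R \<epsilon>'.
       L' > 0 \<and> \<epsilon>' > 0 \<and> R \<ge> 0 \<and> (\<epsilon>' \<le> c * (L' * R\<^sup>2) \<or> R = 0) \<longrightarrow>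
         real (catalyst_K L' R \<epsilon>' * catalyst_T L' \<sigma>' R \<epsilon>')
           \<le> C * (sqrt (L' * R\<^sup>2 / \<epsilon>') + \<sigma>'\<^sup>2 * R\<^sup>2 / \<epsilon>'\<^sup>2)" for c :: real
  proof (intro exI conjI allI impI)
    \<comment> \<open>\<open>c\<close> may be negative, where \<open>sqrt\<close> takes negative
      values; clipping at 0 keeps the constant positive.\<close>
    let ?c = "max c 0"
    let ?A = "4 + sqrt ?c"
    have "?A > 0" by (simp add: add_pos_nonneg)
    then show "9 * ?A + 32 * ?A\<^sup>2 > 0" by (simp add: add_pos_nonneg)
    fix L' \<sigma>' R \<epsilon>' :: real
    assume "L' > 0 \<and> \<epsilon>' > 0 \<and> R \<ge> 0 \<and> (\<epsilon>' \<le> c * (L' * R\<^sup>2) \<or> R = 0)"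
    then have L': "L' > 0" and \<epsilon>': "\<epsilon>' > 0" and R: "R \<ge> 0" and c: "\<epsilon>' \<le> c * (L' * R\<^sup>2) \<or> R = 0"
      by auto
    show "real (catalyst_K L' R \<epsilon>' * catalyst_T L' \<sigma>' R \<epsilon>')
        \<le> (9 * ?A + 32 * ?A\<^sup>2) * (sqrt (L' * R\<^sup>2 / \<epsilon>') + \<sigma>'\<^sup>2 * R\<^sup>2 / \<epsilon>'\<^sup>2)"
    proof (cases "R = 0")
      \<comment> \<open>Here the rounded \<open>K\<close> is 0, so there are no calls.\<close>
      case True
      then show ?thesis by (simp add: catalyst_K_def)
    next
      case False
      have "c * (L' * R\<^sup>2) \<le> ?c * (L' * R\<^sup>2)"
        using L' by (intro mult_right_mono) auto
      then have "\<epsilon>' \<le> ?c * (L' * R\<^sup>2)" using c False by linarith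
      then show ?thesis
        using False R L' \<epsilon>' by (intro catalyst_calls_le) auto
    qed
  qed
  show ?thesis
    using gap calls_eq complexity by (auto simp: run_st)
qed

end
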